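(* Let $A_3$ be a three-dimensional complete left-symmetric algebra over $\mathbb{R}$ whose associated Lie algebra $\mathcal{G}$ is solvable and non-unimodular. Then $A_3$ is isomorphic (as a left-symmetric algebra) to one of the following left-symmetric algebras. Each is given on a basis $e_1,e_2,e_3$ by its non-zero products of basis vectors (all products not listed are zero), followed by its associated Lie algebra (up to isomorphism) and its properties among (N), (D), (S): 1. $N_{3,0}$: $e_1\cdot e_2=e_2$; Lie algebra $\mathcal{G}_{3,1}$; properties N, D, S. 2. $N_{3,1}$: $e_1\cdot e_1=e_3$, $e_1\cdot e_2=e_2$; Lie algebra $\mathcal{G}_{3,1}$; properties N, D, S. 3. $N_{3,2}$: $e_1\cdot e_2=e_2$, $e_3\cdot e_3=e_1$; Lie algebra $\mathcal{G}_{3,1}$; property S. 4. $N_{3,3}$: $e_1\cdot e_2=e_2$, $e_3\cdot e_3=-e_1$; Lie algebra $\mathcal{G}_{3,1}$; property S. 5. $B_{3,0}$: $e_1\cdot e_2=e_2$, $e_1\cdot e_3=e_3$; Lie algebra $\mathcal{G}_{3,2}$; properties N, D, S. 6. $B_{3,1}$: $e_1\cdot e_2=e_2+e_3$, $e_2\cdot e_1=e_3$, $e_1\cdot e_3=e_3$; Lie algebra $\mathcal{G}_{3,2}$; property D. 7. $C_{3,1}$: $e_1\cdot e_2=e_2+e_3$, $e_1\cdot e_3=e_3$; Lie algebra $\mathcal{G}_{3,3}$; properties N, D, S. 8. $C_{3,t}$, $t\in\mathbb{R}$, $t\neq 1$: $e_1\cdot e_2=e_2+te_3$, $e_1\cdot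 e_3=e_3$, $e_2\cdot e_1=(t-1)e_3$; Lie algebra $\mathcal{G}_{3,3}$; property D. 9. $D_{3,1}(\mu)$, $\mu\in\mathbb{R}$, $0<|\mu|<1$: $e_1\cdot e_2=e_2$, $e_1\cdot e_3=\mu e_3$; Lie algebra $\mathcal{G}_{3,4}^{\mu}$; properties N, D, S. 10. $D_{3,2}$: $e_1\cdot e_2=e_2$, $e_1\cdot e_3=\tfrac12 e_3$, $e_3\cdot e_3=e_2$; Lie algebra $\mathcal{G}_{3,4}^{1/2}$; property N. 11. $E_{3,1}(\zeta)$, $\zeta\in\mathbb{R}$, $\zeta>0$: $e_1\cdot e_2=e_2+\zeta e_3$, $e_1\cdot e_3=-\zeta e_2+e_3$; Lie algebra $\mathcal{G}_{3,5}^{\zeta}$; properties N, D, S. Here N means that the algebra is a Novikov algebra, D means that it is a derivation algebra, and S means that it satisfies $[x,y]\cdot z=0$ for all elements $x,y,z$.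
   Context: All vector spaces and algebras are finite-dimensional over $\mathbb{R}$. A left-symmetric algebra is a vector space $A$ with a bilinear product $x\cdot y$ satisfying $(x\cdot y)\cdot z-(y\cdot x)\cdot z=x\cdot(y\cdot z)-y\cdot(x\cdot z)$ for all $x,y,z\in A$. The commutator $[x,y]=x\cdot y-y\cdot x$ is then a Lie bracket on $A$, and $A$ with this bracket is the associated Lie algebra. $A$ is complete if for every $x\in A$ the right multiplication $R_x:y\mapsto y\cdot x$ is a nilpotent operator. $A$ is a Novikov algebra if $(x\cdot y)\cdot z=(x\cdot z)\cdot y$ for all $x,y,z\in A$. $A$ is a derivation algebra if $(x\cdot y)\cdot z=(z\cdot y)\cdot x$ for all $x,y,z\in A$ (equivalently, all left multiplications $y\mapsto x\cdot y$ and right multiplications are derivations of the associated Lie algebra). A Lie algebra $\mathcal{G}$ is unimodular if $\operatorname{tr}(\operatorname{ad}_x)=0$ for all $x\in\mathcal{G}$, and non-unimodular otherwise. The following three-dimensional Lie algebras are given on a basis $e_1,e_2,e_3$ by their non-zero brackets (up to antisymmetry): $\mathcal{G}_{3,1}$: $[e_1,e_2]=e_2$; $\mathcal{G}_{3,2}$: $[e_1,e_2]=e_2$, $[e_1,e_3]=e_3$; $\mathcal{G}_{3,3}$: $[e_1,e_2]=e_2+e_3$, $[e_1,e_3]=e_3$; $\mathcal{G}_{3,4}^{\mu}$ with $0<|\mu|<1$: $[e_1,e_2]=e_2$, $[e_1,e_3]=\mu e_3$; $\mathcal{G}_{3,5}^{\zeta}$ with $\zeta>0$: $[e_1,e_2]=e_2+\zeta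 e_3$, $[e_1,e_3]=-\zeta e_2+e_3$. *)

theory Defs
  imports "HOL-Analysis.Analysis"
begin

definition left_symmetric_algebra :: "('a::real_vector \<Rightarrow> 'a \<Rightarrow> 'a) \<Rightarrow> bool" where
  "left_symmetric_algebra m \<longleftrightarrow> bilinear m \<and>
     (\<forall>x y z. m (m x y) z - m (m y x) z = m x (m y z) - m y (m x z))"

definition commutator :: "('a::real_vector \<Rightarrow> 'a \<Rightarrow> 'a) \<Rightarrow> 'a \<Rightarrow> 'a \<Rightarrow> 'a" where
  "commutator m x y = m x y - m y x"

definition nilpotent_operator :: "('a::real_vector \<Rightarrow> 'a) \<Rightarrow> bool" where
  "nilpotent_operator f \<longleftrightarrow> (\<exists>n. f ^^ n = (\<lambda>y. 0))"

definition complete_algebra :: "('a::real_vector \<Rightarrow> 'a \<Rightarrow> 'a) \<Rightarrow> bool" where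
  "complete_algebra m \<longleftrightarrow> (\<forall>x. nilpotent_operator (\<lambda>y. m y x))"

definition algebra_iso ::
    "('a::real_vector \<Rightarrow> 'a \<Rightarrow> 'a) \<Rightarrow> ('b::real_vector \<Rightarrow> 'b \<Rightarrow> 'b) \<Rightarrow> bool" where
  "algebra_iso m m' \<longleftrightarrow>
     (\<exists>f. linear f \<and> bij f \<and> (\<forall>x y. f (m x y) = m' (f x) (f y)))"

text \<open>The argument of the next notions is the bracket of a Lie algebra whose underlying
  vector space is the whole type.\<close>

fun derived_series :: "('a::real_vector \<Rightarrow> 'a \<Rightarrow> 'a) \<Rightarrow> nat \<Rightarrow> 'a set" where
  "derived_series br 0 = UNIV"
| "derived_series br (Suc n) =
     span {br x y | x y. x \<in> derived_series br n \<and> y \<in> derived_series br n}"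

definition solvable_lie :: "('a::real_vector \<Rightarrow> 'a \<Rightarrow> 'a) \<Rightarrow> bool" where
  "solvable_lie br \<longleftrightarrow> (\<exists>n. derived_series br n = {0})"

text \<open>The trace of an endomorphism of a finite-dimensional space, computed in some basis; the
  lemma below shows that the choice of basis is immaterial.\<close>

definition operator_trace :: "('a::real_vector \<Rightarrow> 'a) \<Rightarrow> real" where
  "operator_trace f =
     (let B = (SOME B. independent B \<and> span B = UNIV) in \<Sum>b\<in>B. representation B (f b) b)"

lemma operator_trace_eq:
  fixes f :: "'a::real_vector \<Rightarrow> 'a"
  assumes f: "linear f" and C: "independent C" "span C = UNIV" "finite C"
  shows "operator_trace f = (\<Sum>c\<in>C. representation C (f c) c)"
proof -
  define B where "B = (SOME B::'a set. independent B \<and> span B = UNIV)"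
  have B: "independent B \<and> span B = UNIV"
    unfolding B_def by (rule someI[of _ C]) (use C in auto)
  have finB: "finite B"
    using independent_span_bound[of C B] B C by auto
  have expB: "v = (\<Sum>b\<in>B. representation B v b *\<^sub>R b)" for v
    using real_vector.sum_representation_eq[of B v B] B finB by auto
  have expC: "v = (\<Sum>c\<in>C. representation C v c *\<^sub>R c)" for v
    using real_vector.sum_representation_eq[of C v C] C by auto
  have linB: "representation B (\<Sum>c\<in>C. g c *\<^sub>R h c) b
      = (\<Sum>c\<in>C. g c * representation B (h c) b)" for g h b
    using B by (simp add: real_vector.representation_sum real_vector.representation_scale)
  have linC: "representation C (\<Sum>b\<in>B. g b *\<^sub>R h b) c
      = (\<Sum>b\<in>B. g b * representation C (h b) c)" for g h c
    using C by (simp add: real_vector.representation_sum real_vector.representation_scale)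
  have "(\<Sum>b\<in>B. representation B (f b) b)
      = (\<Sum>b\<in>B. \<Sum>c\<in>C. representation C (f b) c * representation B c b)"
  proof (rule sum.cong[OF refl])
    fix b
    show "representation B (f b) b = (\<Sum>c\<in>C. representation C (f b) c * representation B c b)"
      by (subst expC[of "f b"]) (rule linB)
  qed
  also have "\<dots> = (\<Sum>c\<in>C. \<Sum>b\<in>B. representation B c b * representation C (f b) c)"
    by (subst sum.swap) (simp add: mult.commute)
  also have "\<dots> = (\<Sum>c\<in>C. representation C (f c) c)"
  proof (rule sum.cong[OF refl])
    fix c
    have "f c = (\<Sum>b\<in>B. representation B c b *\<^sub>R f b)"
      by (subst expB[of c]) (simp add: linear_sum[OF f] linear_scale[OF f])
    then show "(\<Sum>b\<in>B. representation B c b * representation C (f b) c)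
        = representation C (f c) c"
      by (simp add: linC)
  qed
  finally show ?thesis
    by (simp add: operator_trace_def Let_def flip: B_def)
qed

definition unimodular_lie :: "('a::real_vector \<Rightarrow> 'a \<Rightarrow> 'a) \<Rightarrow> bool" where
  "unimodular_lie br \<longleftrightarrow> (\<forall>x. operator_trace (br x) = 0)"

definition novikov_algebra :: "('a::real_vector \<Rightarrow> 'a \<Rightarrow> 'a) \<Rightarrow> bool" where
  "novikov_algebra m \<longleftrightarrow>
     left_symmetric_algebra m \<and> (\<forall>x y z. m (m x y) z = m (m x z) y)"

definition derivation_algebra :: "('a::real_vector \<Rightarrow> 'a \<Rightarrow> 'a) \<Rightarrow> bool" where
  "derivation_algebra m \<longleftrightarrow>
     left_symmetric_algebra m \<and> (\<forall>x y z. m (m x y) z = m (m z y) x)"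

datatype lsa_property = PropN | PropD | PropS

fun has_property :: "('a::real_vector \<Rightarrow> 'a \<Rightarrow> 'a) \<Rightarrow> lsa_property \<Rightarrow> bool" where
  "has_property m PropN \<longleftrightarrow> novikov_algebra m"
| "has_property m PropD \<longleftrightarrow> derivation_algebra m"
| "has_property m PropS \<longleftrightarrow> (\<forall>x y z. m (commutator m x y) z = 0)"

text \<open>A row of the classification table: a left-symmetric algebra, its associated Lie algebra
  up to isomorphism, and exactly those properties that it has.\<close>

definition table_entry ::
    "('a::real_vector \<Rightarrow> 'a \<Rightarrow> 'a) \<Rightarrow> ('b::real_vector \<Rightarrow> 'b \<Rightarrow> 'b) \<Rightarrow> lsa_property set \<Rightarrow> bool" where
  "table_entry m g P \<longleftrightarrow>
     left_symmetric_algebra m \<and> algebra_iso (commutator m) g \<and> {p. has_property m p} = P"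

abbreviation e1 :: "real^3" where "e1 \<equiv> axis 1 1"
abbreviation e2 :: "real^3" where "e2 \<equiv> axis 2 1"
abbreviation e3 :: "real^3" where "e3 \<equiv> axis 3 1"

text \<open>An item \<open>((i, j), v)\<close> of the list prescribes the product (or the bracket) of the
  \<open>i\<close>-th and the \<open>j\<close>-th basis vector to be \<open>v\<close>; products of basis vectors that are not listed
  are zero. For brackets only one of \<open>(i, j)\<close> and \<open>(j, i)\<close> is listed.\<close>

definition product_of :: "((3 \<times> 3) \<times> (real^3)) list \<Rightarrow> real^3 \<Rightarrow> real^3 \<Rightarrow> real^3" where
  "product_of ps x y = (\<Sum>((i, j), v)\<leftarrow>ps. (x $ i * y $ j) *\<^sub>R v)"

definition bracket_of :: "((3 \<times> 3) \<times> (real^3)) list \<Rightarrow> real^3 \<Rightarrow> real^3 \<Rightarrow> real^3" where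
  "bracket_of ps x y = (\<Sum>((i, j), v)\<leftarrow>ps. (x $ i * y $ j - x $ j * y $ i) *\<^sub>R v)"

definition G31 :: "real^3 \<Rightarrow> real^3 \<Rightarrow> real^3" where
  "G31 = bracket_of [((1, 2), e2)]"

definition G32 :: "real^3 \<Rightarrow> real^3 \<Rightarrow> real^3" where
  "G32 = bracket_of [((1, 2), e2), ((1, 3), e3)]"

definition G33 :: "real^3 \<Rightarrow> real^3 \<Rightarrow> real^3" where
  "G33 = bracket_of [((1, 2), e2 + e3), ((1, 3), e3)]"

definition G34 :: "real \<Rightarrow> real^3 \<Rightarrow> real^3 \<Rightarrow> real^3" where
  "G34 \<mu> = bracket_of [((1, 2), e2), ((1, 3), \<mu> *\<^sub>R e3)]"

definition G35 :: "real \<Rightarrow> real^3 \<Rightarrow> real^3 \<Rightarrow> real^3" where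
  "G35 \<zeta> = bracket_of [((1, 2), e2 + \<zeta> *\<^sub>R e3), ((1, 3), - (\<zeta> *\<^sub>R e2) + e3)]"

definition N30 :: "real^3 \<Rightarrow> real^3 \<Rightarrow> real^3" where
  "N30 = product_of [((1, 2), e2)]"

definition N31 :: "real^3 \<Rightarrow> real^3 \<Rightarrow> real^3" where
  "N31 = product_of [((1, 1), e3), ((1, 2), e2)]"

definition N32 :: "real^3 \<Rightarrow> real^3 \<Rightarrow> real^3" where
  "N32 = product_of [((1, 2), e2), ((3, 3), e1)]"

definition N33 :: "real^3 \<Rightarrow> real^3 \<Rightarrow> real^3" where
  "N33 = product_of [((1, 2), e2), ((3, 3), - e1)]"

definition B30 :: "real^3 \<Rightarrow> real^3 \<Rightarrow> real^3" where
  "B30 = product_of [((1, 2), e2), ((1, 3), e3)]"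

definition B31 :: "real^3 \<Rightarrow> real^3 \<Rightarrow> real^3" where
  "B31 = product_of [((1, 2), e2 + e3), ((2, 1), e3), ((1, 3), e3)]"

definition C31 :: "real^3 \<Rightarrow> real^3 \<Rightarrow> real^3" where
  "C31 = product_of [((1, 2), e2 + e3), ((1, 3), e3)]"

definition C3 :: "real \<Rightarrow> real^3 \<Rightarrow> real^3 \<Rightarrow> real^3" where
  "C3 t = product_of [((1, 2), e2 + t *\<^sub>R e3), ((1, 3), e3), ((2, 1), (t - 1) *\<^sub>R e3)]"

definition D31 :: "real \<Rightarrow> real^3 \<Rightarrow> real^3 \<Rightarrow> real^3" where
  "D31 \<mu> = product_of [((1, 2), e2), ((1, 3), \<mu> *\<^sub>R e3)]"

definition D32 :: "real^3 \<Rightarrow> real^3 \<Rightarrow> real^3" where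
  "D32 = product_of [((1, 2), e2), ((1, 3), (1/2) *\<^sub>R e3), ((3, 3), e2)]"

definition E31 :: "real \<Rightarrow> real^3 \<Rightarrow> real^3 \<Rightarrow> real^3" where
  "E31 \<zeta> = product_of [((1, 2), e2 + \<zeta> *\<^sub>R e3), ((1, 3), - (\<zeta> *\<^sub>R e2) + e3)]"

end

theory Submission
  imports Defs
begin

text \<open>
  Write \<open>L\<^sub>x\<close> and \<open>R\<^sub>x\<close> for left and right multiplication. Completeness makes every \<open>R\<^sub>x\<close>
  traceless, so the functional \<open>h x = tr (ad x)\<close> equals \<open>tr L\<^sub>x\<close>, and it vanishes on brackets
  because \<open>L\<close> is a representation of the Lie algebra. If \<open>h\<close> is not zero, its kernel is a plane
  \<open>U\<close>, and reading off \<open>h\<close> in a basis shows that \<open>U\<close> is an abelian ideal. The Lie algebra is thus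
  given by one operator \<open>D\<close>, the restriction of \<open>ad e\<close> to \<open>U\<close>, of non-zero trace
  (\<open>ex_adapted\<close>).

  Completeness enters further through the fact that \<open>R\<^sub>x\<close> has no non-zero eigenvalue; in particular a
  non-zero \<open>x\<close> is never of the form \<open>x \<cdot> y\<close>. Together with the Cayley-Hamilton identity this
  forces every real eigenvalue of \<open>ad e\<close> to be a root of the characteristic
  polynomial of \<open>L\<^sub>e\<close> (\<open>bracket_eigenvalue_root\<close>). The eigenvector \<open>e\<close> itself shows that \<open>0\<close> is such
  a root, and \<open>tr L\<^sub>e = tr D\<close>.

  If \<open>D\<close> is invertible, all products lie in \<open>U\<close> (\<open>product_in_plane\<close>). The commutative product of
  \<open>U\<close> has nilpotent multiplications, so it is zero or has a basis with \<open>f \<cdot> f = g\<close> as its only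
  non-zero product (\<open>nilpotent_commutative_plane\<close>). The second alternative gives \<open>D\<^sub>3\<^sub>,\<^sub>2\<close>. In the
  first, \<open>R\<^sub>e\<close> is nilpotent on \<open>U\<close>: if it is not zero there, the identities make \<open>D\<close> a scalar plus
  a multiple of it and the algebra is \<open>B\<^sub>3\<^sub>,\<^sub>1\<close> or \<open>C\<^sub>3\<^sub>,\<^sub>t\<close>; if it is zero, \<open>e\<close> can be corrected to
  satisfy \<open>e \<cdot> e = 0\<close>, and only the normal form of \<open>D\<close> remains, which gives the families
  \<open>B\<^sub>3\<^sub>,\<^sub>0\<close>, \<open>C\<^sub>3\<^sub>,\<^sub>1\<close>, \<open>D\<^sub>3\<^sub>,\<^sub>1\<close>, \<open>E\<^sub>3\<^sub>,\<^sub>1\<close>.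

  If \<open>D\<close> is singular, it is diagonalisable, with eigenvectors \<open>f\<close> for \<open>1\<close> (after scaling \<open>e\<close>) and
  \<open>g\<close> for \<open>0\<close>. Then \<open>L\<^sub>f = 0\<close>, and \<open>e\<close> can be chosen so that \<open>e, g\<close> span the kernel of the square
  of \<open>L\<^sub>e\<close> (\<open>singular_annihilator\<close>, \<open>classification_singular\<close>). This kernel is a subalgebra to
  which \<open>nilpotent_commutative_plane\<close> applies; the position in it of the square
  \<open>f \<cdot> f\<close>, if there is one, distinguishes the four algebras \<open>N\<close>.

  The rows of the table are verified by computing in coordinates; the commutator of each algebra is
  literally the listed bracket.
\<close>

section \<open>Bases of a three-dimensional space\<close>

definition frame :: "'a::real_vector \<Rightarrow> 'a \<Rightarrow> 'a \<Rightarrow> bool" where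
  "frame a b c \<longleftrightarrow>
     (\<forall>p q r. p *\<^sub>R a + q *\<^sub>R b + r *\<^sub>R c = 0 \<longrightarrow> p = 0 \<and> q = 0 \<and> r = 0) \<and>
     (\<forall>x. \<exists>p q r. x = p *\<^sub>R a + q *\<^sub>R b + r *\<^sub>R c)"

lemma frame_zero_iff:
  assumes "frame a b c"
  shows "p *\<^sub>R a + q *\<^sub>R b + r *\<^sub>R c = 0 \<longleftrightarrow> p = 0 \<and> q = 0 \<and> r = 0"
  using assms by (auto simp: frame_def)

lemma frame_eq_iff:
  assumes "frame a b c"
  shows "p *\<^sub>R a + q *\<^sub>R b + r *\<^sub>R c = p' *\<^sub>R a + q' *\<^sub>R b + r' *\<^sub>R c
    \<longleftrightarrow> p = p' \<and> q = q' \<and> r = r'"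
proof -
  have "p *\<^sub>R a + q *\<^sub>R b + r *\<^sub>R c = p' *\<^sub>R a + q' *\<^sub>R b + r' *\<^sub>R c
    \<longleftrightarrow> (p - p') *\<^sub>R a + (q - q') *\<^sub>R b + (r - r') *\<^sub>R c = 0"
    by (simp add: algebra_simps)
  then show ?thesis
    using frame_zero_iff[OF assms] by auto
qed

lemma frame_coords:
  assumes "frame a b c"
  obtains p q r where "x = p *\<^sub>R a + q *\<^sub>R b + r *\<^sub>R c"
  using assms unfolding frame_def by blast

lemma frame_independent:
  assumes "frame a b c"
  shows "independent {a, b, c}" "a \<noteq> b" "a \<noteq> c" "b \<noteq> c" "span {a, b, c} = UNIV"
proof -
  note z = frame_zero_iff[OF assms]
  show ab: "a \<noteq> b" using z[of 1 "-1" 0] by auto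
  show ac: "a \<noteq> c" using z[of 1 0 "-1"] by auto
  show bc: "b \<noteq> c" using z[of 0 1 "-1"] by auto
  show "independent {a, b, c}"
    using ab ac bc z by (auto simp: real_vector.dependent_finite add.assoc)
  show "span {a, b, c} = UNIV"
  proof (rule UNIV_eq_I[symmetric])
    fix x
    obtain p q r where "x = p *\<^sub>R a + q *\<^sub>R b + r *\<^sub>R c"
      using frame_coords[OF assms] .
    then show "x \<in> span {a, b, c}"
      by (simp add: span_add span_scale span_base)
  qed
qed

lemma independent_triple_frame:
  fixes a b c :: "'a::real_vector"
  assumes dim: "dim (UNIV :: 'a set) = 3"
    and ind: "\<And>p q r. p *\<^sub>R a + q *\<^sub>R b + r *\<^sub>R c = 0 \<Longrightarrow> p = 0 \<and> q = 0 \<and> r = 0"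
  shows "frame a b c"
proof -
  have ab: "a \<noteq> b" using ind[of 1 "-1" 0] by auto
  have ac: "a \<noteq> c" using ind[of 1 0 "-1"] by auto
  have bc: "b \<noteq> c" using ind[of 0 1 "-1"] by auto
  have indep: "independent {a, b, c}"
    using ab ac bc ind by (auto simp: real_vector.dependent_finite add.assoc)
  obtain B :: "'a set" where B: "independent B" "UNIV \<subseteq> span B" "card B = 3"
    using basis_exists[of "UNIV :: 'a set"] dim by metis
  then have "finite B" by (metis card.infinite zero_neq_numeral)
  have spanning: "x \<in> span {a, b, c}" for x
  proof (rule ccontr)
    assume x: "x \<notin> span {a, b, c}"
    then have "independent (insert x {a, b, c})"
      using indep by (simp add: independent_insert)
    then have "card (insert x {a, b, c}) \<le> card B"
      using independent_span_bound[OF \<open>finite B\<close>] B by blast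
    moreover have "x \<notin> {a, b, c}" using x span_base[of x "{a, b, c}"] by blast
    ultimately show False using B ab ac bc by simp
  qed
  have "\<exists>p q r. x = p *\<^sub>R a + q *\<^sub>R b + r *\<^sub>R c" for x
  proof -
    obtain p where "x - p *\<^sub>R a \<in> span {b, c}"
      using spanning[of x] unfolding span_breakdown_eq[of x] by blast
    then obtain q where "x - p *\<^sub>R a - q *\<^sub>R b \<in> span {c}"
      unfolding span_breakdown_eq[of _ b] by blast
    then obtain r where "x - p *\<^sub>R a - q *\<^sub>R b = r *\<^sub>R c"
      unfolding span_singleton by blast
    then have "x = p *\<^sub>R a + q *\<^sub>R b + r *\<^sub>R c"
      by (metis add.commute add.left_commute diff_add_cancel)
    then show ?thesis by blast
  qed
  then show ?thesis using ind by (auto simp: frame_def)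
qed

lemma ex_frame:
  assumes dim: "dim (UNIV :: 'a::real_vector set) = 3"
  shows "\<exists>a b c :: 'a. frame a b c"
proof -
  obtain B :: "'a set" where B: "independent B" "UNIV \<subseteq> span B" "card B = 3"
    using basis_exists[of "UNIV :: 'a set"] dim by metis
  obtain a b c where abc: "B = {a, b, c}" "a \<noteq> b" "a \<noteq> c" "b \<noteq> c"
    using B(3) card_3_iff by metis
  have ind: "p = 0 \<and> q = 0 \<and> r = 0" if "p *\<^sub>R a + q *\<^sub>R b + r *\<^sub>R c = 0" for p q r
  proof -
    define u where "u x = (if x = a then p else if x = b then q else r)" for x
    have "(\<Sum>v\<in>{a, b, c}. u v *\<^sub>R v) = 0"
      using that abc by (simp add: u_def add.assoc)
    then have "\<forall>v\<in>{a, b, c}. u v = 0"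
      using B(1) unfolding abc(1) by (auto simp: real_vector.dependent_finite)
    then show ?thesis using abc by (simp add: u_def)
  qed
  show ?thesis using independent_triple_frame[OF dim ind] by blast
qed

text \<open>
  A change of basis that respects the plane spanned by the last two vectors.
\<close>

lemma frame_change:
  fixes e u v :: "'a::real_vector"
  assumes dim: "dim (UNIV :: 'a set) = 3" and F: "frame e u v"
    and k: "k \<noteq> 0" and det: "\<alpha> * \<delta> - \<beta> * \<gamma> \<noteq> 0"
  shows "frame (k *\<^sub>R e + y *\<^sub>R u + z *\<^sub>R v) (\<alpha> *\<^sub>R u + \<beta> *\<^sub>R v) (\<gamma> *\<^sub>R u + \<delta> *\<^sub>R v)"
proof (rule independent_triple_frame[OF dim])
  fix p q r
  assume "p *\<^sub>R (k *\<^sub>R e + y *\<^sub>R u + z *\<^sub>R v) + q *\<^sub>R (\<alpha> *\<^sub>R u + \<beta> *\<^sub>R v) + r *\<^sub>R (\<gamma> *\<^sub>R u + \<delta> *\<^sub>R v) = 0"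
  then have "(p * k) *\<^sub>R e + (p * y + q * \<alpha> + r * \<gamma>) *\<^sub>R u + (p * z + q * \<beta> + r * \<delta>) *\<^sub>R v = 0"
    by (simp add: algebra_simps)
  then have eq: "p = 0" "q * \<alpha> + r * \<gamma> = 0" "q * \<beta> + r * \<delta> = 0"
    using k by (auto simp: frame_zero_iff[OF F])
  have "q * (\<alpha> * \<delta> - \<beta> * \<gamma>) = 0" "r * (\<alpha> * \<delta> - \<beta> * \<gamma>) = 0"
    using eq by algebra+
  then show "p = 0 \<and> q = 0 \<and> r = 0" using det eq by simp
qed

lemma frame_swap:
  fixes a b c :: "'a::real_vector"
  assumes dim: "dim (UNIV :: 'a set) = 3" and F: "frame a b c"
  shows "frame b a c"
proof (rule independent_triple_frame[OF dim])
  show "p = 0 \<and> q = 0 \<and> r = 0" if "p *\<^sub>R b + q *\<^sub>R a + r *\<^sub>R c = 0" for p q r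
    using frame_zero_iff[OF F, of q p r] that by (simp add: add.commute)
qed

section \<open>Traces and the Cayley-Hamilton identity\<close>

lemma operator_trace_frame:
  assumes F: "frame a b c" and f: "linear f"
    and fa: "f a = p1 *\<^sub>R a + q1 *\<^sub>R b + r1 *\<^sub>R c"
    and fb: "f b = p2 *\<^sub>R a + q2 *\<^sub>R b + r2 *\<^sub>R c"
    and fc: "f c = p3 *\<^sub>R a + q3 *\<^sub>R b + r3 *\<^sub>R c"
  shows "operator_trace f = p1 + q2 + r3"
proof -
  note I = frame_independent[OF F]
  let ?R = "representation {a, b, c}"
  have basis: "?R a a = 1" "?R a b = 0" "?R a c = 0" "?R b a = 0" "?R b b = 1" "?R b c = 0"
    "?R c a = 0" "?R c b = 0" "?R c c = 1"
    using I by (simp_all add: real_vector.representation_basis)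
  have lin: "?R (p *\<^sub>R a + q *\<^sub>R b + r *\<^sub>R c) v = p * ?R a v + q * ?R b v + r * ?R c v" for p q r v
    using I by (simp add: real_vector.representation_add real_vector.representation_scale)
  show ?thesis
    using operator_trace_eq[OF f I(1) I(5)] I(2-4) by (simp add: fa fb fc lin basis)
qed

lemma linear_frame_eqI:
  assumes F: "frame a b c" and "linear f" "linear g" "f a = g a" "f b = g b" "f c = g c"
  shows "f x = g x"
proof -
  obtain p q r where "x = p *\<^sub>R a + q *\<^sub>R b + r *\<^sub>R c" using frame_coords[OF F] .
  then show ?thesis using assms by (simp add: linear_add linear_scale)
qed

lemma operator_trace_algebra:
  fixes f g :: "'a::real_vector \<Rightarrow> 'a"
  assumes dim: "dim (UNIV :: 'a set) = 3" and f: "linear f" and g: "linear g"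
  shows "operator_trace (\<lambda>x. f x + g x) = operator_trace f + operator_trace g"
    and "operator_trace (\<lambda>x. k *\<^sub>R f x) = k * operator_trace f"
    and "operator_trace (\<lambda>x. f (g x)) = operator_trace (\<lambda>x. g (f x))"
proof -
  obtain a b c :: 'a where F: "frame a b c" using ex_frame[OF dim] by blast
  obtain p1 q1 r1 where fa: "f a = p1 *\<^sub>R a + q1 *\<^sub>R b + r1 *\<^sub>R c" using frame_coords[OF F] .
  obtain p2 q2 r2 where fb: "f b = p2 *\<^sub>R a + q2 *\<^sub>R b + r2 *\<^sub>R c" using frame_coords[OF F] .
  obtain p3 q3 r3 where fc: "f c = p3 *\<^sub>R a + q3 *\<^sub>R b + r3 *\<^sub>R c" using frame_coords[OF F] .
  obtain u1 v1 w1 where ga: "g a = u1 *\<^sub>R a + v1 *\<^sub>R b + w1 *\<^sub>R c" using frame_coords[OF F] .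
  obtain u2 v2 w2 where gb: "g b = u2 *\<^sub>R a + v2 *\<^sub>R b + w2 *\<^sub>R c" using frame_coords[OF F] .
  obtain u3 v3 w3 where gc: "g c = u3 *\<^sub>R a + v3 *\<^sub>R b + w3 *\<^sub>R c" using frame_coords[OF F] .
  note tf = operator_trace_frame[OF F f fa fb fc] and tg = operator_trace_frame[OF F g ga gb gc]
  have "operator_trace (\<lambda>x. f x + g x) = (p1 + u1) + (q2 + v2) + (r3 + w3)"
    by (rule operator_trace_frame[OF F, where ?q1.0 = "q1 + v1" and ?r1.0 = "r1 + w1"
          and ?p2.0 = "p2 + u2" and ?r2.0 = "r2 + w2" and ?p3.0 = "p3 + u3" and ?q3.0 = "q3 + v3"])
      (auto intro!: linear_compose_add f g simp: fa fb fc ga gb gc algebra_simps)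
  then show "operator_trace (\<lambda>x. f x + g x) = operator_trace f + operator_trace g"
    by (simp add: tf tg)
  have "operator_trace (\<lambda>x. k *\<^sub>R f x) = k * p1 + k * q2 + k * r3"
    by (rule operator_trace_frame[OF F, where ?q1.0 = "k * q1" and ?r1.0 = "k * r1"
          and ?p2.0 = "k * p2" and ?r2.0 = "k * r2" and ?p3.0 = "k * p3" and ?q3.0 = "k * q3"])
      (auto intro!: linear_compose_scale_right f simp: fa fb fc algebra_simps)
  then show "operator_trace (\<lambda>x. k *\<^sub>R f x) = k * operator_trace f"
    by (simp add: tf algebra_simps)
  note lin = linear_add[OF f] linear_scale[OF f] linear_add[OF g] linear_scale[OF g]
  have "operator_trace (\<lambda>x. f (g x)) =
    (u1 * p1 + v1 * p2 + w1 * p3) + (u2 * q1 + v2 * q2 + w2 * q3) + (u3 * r1 + v3 * r2 + w3 * r3)"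
    by (rule operator_trace_frame[OF F, where ?q1.0 = "u1 * q1 + v1 * q2 + w1 * q3" 
          and ?r1.0 = "u1 * r1 + v1 * r2 + w1 * r3"
          and ?p2.0 = "u2 * p1 + v2 * p2 + w2 * p3" and ?r2.0 = "u2 * r1 + v2 * r2 + w2 * r3" 
          and ?p3.0 = "u3 * p1 + v3 * p2 + w3 * p3" and ?q3.0 = "u3 * q1 + v3 * q2 + w3 * q3"])
      (use linear_compose[OF g f] in \<open>simp_all add: o_def fa fb fc ga gb gc lin algebra_simps\<close>)
  moreover have "operator_trace (\<lambda>x. g (f x)) =
    (p1 * u1 + q1 * u2 + r1 * u3) + (p2 * v1 + q2 * v2 + r2 * v3) + (p3 * w1 + q3 * w2 + r3 * w3)"
    by (rule operator_trace_frame[OF F, where ?q1.0 = "p1 * v1 + q1 * v2 + r1 * v3" 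
          and ?r1.0 = "p1 * w1 + q1 * w2 + r1 * w3"
          and ?p2.0 = "p2 * u1 + q2 * u2 + r2 * u3" and ?r2.0 = "p2 * w1 + q2 * w2 + r2 * w3" 
          and ?p3.0 = "p3 * u1 + q3 * u2 + r3 * u3" and ?q3.0 = "p3 * v1 + q3 * v2 + r3 * v3"])
      (use linear_compose[OF f g] in \<open>simp_all add: o_def fa fb fc ga gb gc lin algebra_simps\<close>)
  ultimately show "operator_trace (\<lambda>x. f (g x)) = operator_trace (\<lambda>x. g (f x))"
    by (simp add: algebra_simps)
qed

text \<open>
  The middle coefficient is given explicitly, as half of \<open>(tr f)\<^sup>2 - tr f\<^sup>2\<close>: it is what
  turns nilpotency into a statement on traces. The constant coefficient, the determinant, is only
  needed up to its existence.
\<close>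

lemma cayley_hamilton_3:
  fixes f :: "'a::real_vector \<Rightarrow> 'a"
  assumes dim: "dim (UNIV :: 'a set) = 3" and f: "linear f"
  shows "\<exists>k. \<forall>x. f (f (f x)) = operator_trace f *\<^sub>R f (f x)
    - (((operator_trace f)\<^sup>2 - operator_trace (\<lambda>x. f (f x))) / 2) *\<^sub>R f x + k *\<^sub>R x"
proof -
  obtain a b c :: 'a where F: "frame a b c" using ex_frame[OF dim] by blast
  obtain p1 q1 r1 where fa: "f a = p1 *\<^sub>R a + q1 *\<^sub>R b + r1 *\<^sub>R c" using frame_coords[OF F] .
  obtain p2 q2 r2 where fb: "f b = p2 *\<^sub>R a + q2 *\<^sub>R b + r2 *\<^sub>R c" using frame_coords[OF F] .
  obtain p3 q3 r3 where fc: "f c = p3 *\<^sub>R a + q3 *\<^sub>R b + r3 *\<^sub>R c" using frame_coords[OF F] .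
  note lin = linear_add[OF f] linear_scale[OF f]
  have tf: "operator_trace f = p1 + q2 + r3" by (rule operator_trace_frame[OF F f fa fb fc])
  have "operator_trace (\<lambda>x. f (f x)) =
    (p1 * p1 + q1 * p2 + r1 * p3) + (p2 * q1 + q2 * q2 + r2 * q3) + (p3 * r1 + q3 * r2 + r3 * r3)"
    by (rule operator_trace_frame[OF F, where ?q1.0 = "p1 * q1 + q1 * q2 + r1 * q3" 
          and ?r1.0 = "p1 * r1 + q1 * r2 + r1 * r3"
          and ?p2.0 = "p2 * p1 + q2 * p2 + r2 * p3" and ?r2.0 = "p2 * r1 + q2 * r2 + r2 * r3" 
          and ?p3.0 = "p3 * p1 + q3 * p2 + r3 * p3" and ?q3.0 = "p3 * q1 + q3 * q2 + r3 * q3"])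
      (use linear_compose[OF f f] in \<open>simp_all add: o_def fa fb fc lin algebra_simps\<close>)
  then have c2: "((operator_trace f)\<^sup>2 - operator_trace (\<lambda>x. f (f x))) / 2 =
      p1 * q2 - q1 * p2 + p1 * r3 - r1 * p3 + q2 * r3 - q3 * r2" (is "_ = ?c2")
    by (simp add: tf power2_eq_square field_simps)
  let ?k = "p1 * (q2 * r3 - q3 * r2) - q1 * (p2 * r3 - p3 * r2) + r1 * (p2 * q3 - p3 * q2)"
  let ?g = "\<lambda>x. (p1 + q2 + r3) *\<^sub>R f (f x) - ?c2 *\<^sub>R f x + ?k *\<^sub>R x"
  have "linear (\<lambda>x. f (f (f x)))"
    using linear_compose[OF linear_compose[OF f f] f] by (simp add: o_def)
  moreover have "linear ?g"
    by (rule linearI) (simp_all add: lin algebra_simps)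
  ultimately have "f (f (f x)) = ?g x" for x
    by (rule linear_frame_eqI[OF F]) (simp_all add: fa fb fc lin algebra_simps)
  then show ?thesis
    unfolding c2 unfolding tf by blast
qed

text \<open>
  Let \<open>f\<^sup>k = 0\<close> with \<open>k\<close> minimal. Applying the Cayley-Hamilton identity to \<open>f\<^sup>k\<^sup>-\<^sup>1 z\<close>, \<open>f\<^sup>k\<^sup>-\<^sup>2 z\<close> and
  \<open>f\<^sup>k\<^sup>-\<^sup>3 z\<close> in turn kills its coefficients, the constant one first. For \<open>k = 2\<close> the last of
  these vectors is not available, but then \<open>f\<^sup>2\<close> is zero and the middle coefficient is half of
  \<open>(tr f)\<^sup>2\<close>.
\<close>

lemma nilpotent_operator_trace:
  fixes f :: "'a::real_vector \<Rightarrow> 'a"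
  assumes dim: "dim (UNIV :: 'a set) = 3" and f: "linear f" and n: "nilpotent_operator f"
  shows "operator_trace f = 0"
proof -
  define k where "k = (LEAST n. f ^^ n = (\<lambda>y. 0))"
  have k: "f ^^ k = (\<lambda>y. 0)" and least: "\<And>j. j < k \<Longrightarrow> f ^^ j \<noteq> (\<lambda>y. 0)"
    using n LeastI_ex[of "\<lambda>n. f ^^ n = (\<lambda>y. 0)"] not_less_Least
    unfolding nilpotent_operator_def k_def by (blast, blast)
  have zero: "operator_trace (\<lambda>x. 0 :: 'a) = 0"
    using operator_trace_algebra(2)[OF dim f f, of 0] by simp
  obtain c where CH: "\<And>x. f (f (f x)) = operator_trace f *\<^sub>R f (f x)
    - (((operator_trace f)\<^sup>2 - operator_trace (\<lambda>x. f (f x))) / 2) *\<^sub>R f x + c *\<^sub>R x"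
    using cayley_hamilton_3[OF dim f] by blast
  define d where "d = ((operator_trace f)\<^sup>2 - operator_trace (\<lambda>x. f (f x))) / 2"
  obtain j where j: "k = Suc j"
  proof (cases k)
    case 0
    then have "x = 0" for x :: 'a using k by (metis funpow_0)
    moreover obtain a b c :: 'a where "frame a b c" using ex_frame[OF dim] by blast
    ultimately have False using frame_independent(2) by metis
    then show thesis ..
  qed auto
  \<comment> \<open>\<open>z\<close> survives \<open>j = k - 1\<close> applications of \<open>f\<close> but not one more.\<close>
  obtain z where z: "(f ^^ j) z \<noteq> 0" using least[of j] j by fastforce
  have kz: "f ((f ^^ j) x) = 0" for x using k j by (metis funpow.simps(2) comp_apply)
  have f0: "f 0 = 0" using linear_0[OF f] .
  have c: "c = 0" using CH[of "(f ^^ j) z"] kz f0 z by simp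
  show ?thesis
  proof (cases j)
    case 0
    then have "f = (\<lambda>x. 0)" using kz by auto
    then show ?thesis using zero by simp
  next
    case (Suc i)
    have d: "d = 0"
      using CH[of "(f ^^ i) z"] kz z f0 c unfolding d_def[symmetric] Suc by simp
    show ?thesis
    proof (cases i)
      case 0
      then have "operator_trace (\<lambda>x. f (f x)) = 0" using kz Suc zero by simp
      then show ?thesis using d by (simp add: d_def)
    next
      case (Suc l)
      then show ?thesis
        using CH[of "(f ^^ l) z"] kz z f0 c d \<open>j = Suc i\<close> unfolding d_def[symmetric] by simp
    qed
  qed
qed

section \<open>Linear functionals and planar eigenvectors\<close>

lemma ex_separating_functional:
  fixes S :: "'a::real_vector set"
  assumes S: "subspace S" and x: "x \<notin> S"
  shows "\<exists>\<phi> :: 'a \<Rightarrow> real. linear \<phi> \<and> \<phi> x = 1 \<and> (\<forall>y\<in>S. \<phi> y = 0)"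
proof -
  obtain B where B: "B \<subseteq> S" "independent B" "S \<subseteq> span B"
    using basis_exists[of S] by metis
  then have "span B = S" using S by (metis span_eq_iff span_mono subset_antisym)
  then have "x \<notin> span B" using x by simp
  then have "independent (insert x B)" "x \<notin> B" using B(2) span_base by (auto simp: independent_insert)
  then obtain \<phi> :: "'a \<Rightarrow> real" where \<phi>: "linear \<phi>" "\<forall>y\<in>insert x B. \<phi> y = (if y = x then 1 else 0)"
    using linear_independent_extend[of "insert x B" "\<lambda>y. if y = x then 1 else 0"] by blast
  have "\<phi> b = 0" if "b \<in> B" for b using \<phi>(2) \<open>x \<notin> B\<close> that by auto
  then have "\<phi> y = 0" if "y \<in> S" for y
    using linear_eq_0_on_span[OF \<phi>(1), of B y] that \<open>span B = S\<close> by blast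
  then show ?thesis using \<phi> by auto
qed

text \<open>
  The matrix acts on rows, as do the coordinates of a vector when \<open>a, b\<close> and \<open>c, d\<close> are those of
  the images of the two basis vectors.
\<close>

lemma ex_eigenvector_2x2:
  fixes a b c d k :: real
  assumes "k\<^sup>2 - (a + d) * k + (a * d - b * c) = 0"
  shows "\<exists>q r. (q \<noteq> 0 \<or> r \<noteq> 0) \<and> q * a + r * c = k * q \<and> q * b + r * d = k * r"
proof -
  have k: "(a - k) * (d - k) = b * c"
    using assms by (simp add: power2_eq_square algebra_simps)
  consider "c \<noteq> 0 \<or> k \<noteq> a" | "c = 0" "k = a" "k \<noteq> d \<or> b \<noteq> 0" | "c = 0" "k = a" "k = d" "b = 0"
    by blast
  then show ?thesis
  proof cases
    case 1
    then show ?thesis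
      using k by (intro exI[of _ c] exI[of _ "k - a"]) (auto simp: algebra_simps)
  next
    case 2
    then show ?thesis
      by (intro exI[of _ "k - d"] exI[of _ b]) (auto simp: algebra_simps)
  next
    case 3
    then show ?thesis by (intro exI[of _ 1] exI[of _ 0]) auto
  qed
qed

text \<open>
  The determinant \<open>q * r' - r * q'\<close> of two eigenvectors \<open>(q, r)\<close> and \<open>(q', r')\<close> for different
  eigenvalues does not vanish.
\<close>

lemma eigenvectors_independent_2x2:
  fixes a b c d k l :: real
  assumes "k \<noteq> l" and "q \<noteq> 0 \<or> r \<noteq> 0" "q * a + r * c = k * q" "q * b + r * d = k * r"
    and "q' \<noteq> 0 \<or> r' \<noteq> 0" "q' * a + r' * c = l * q'" "q' * b + r' * d = l * r'"
  shows "q * r' - r * q' \<noteq> 0"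
proof
  assume 0: "q * r' - r * q' = 0"
  have "(k - l) * (q * q') = (q * a + r * c) * q' - (q' * a + r' * c) * q"
    using assms by (simp add: algebra_simps)
  also have "\<dots> = 0" using 0 by algebra
  finally have 1: "q * q' = 0" using assms(1) by simp
  have "(k - l) * (r * r') = (q * b + r * d) * r' - (q' * b + r' * d) * r"
    using assms by (simp add: algebra_simps)
  also have "\<dots> = 0" using 0 by algebra
  finally have "r * r' = 0" using assms(1) by simp
  then show False using 0 1 assms(2,5) by auto
qed

section \<open>The algebras of the table\<close>

lemma bij_frame_combination:
  assumes F: "frame a b c"
  shows "linear (\<lambda>v :: real^3. v $ 1 *\<^sub>R a + v $ 2 *\<^sub>R b + v $ 3 *\<^sub>R c)" (is "linear ?g")
    and "bij (\<lambda>v :: real^3. v $ 1 *\<^sub>R a + v $ 2 *\<^sub>R b + v $ 3 *\<^sub>R c)"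
proof -
  show "linear ?g" by (rule linearI) (simp_all add: algebra_simps)
  have "inj ?g"
    by (rule injI) (simp add: frame_eq_iff[OF F] vec_eq_iff forall_3)
  moreover have "\<exists>v. x = ?g v" for x
  proof -
    obtain p q r where "x = p *\<^sub>R a + q *\<^sub>R b + r *\<^sub>R c" using frame_coords[OF F] .
    then have "x = ?g (vector [p, q, r])" by (simp add: vector_3)
    then show ?thesis by blast
  qed
  ultimately show "bij ?g" by (auto simp: bij_def surj_def)
qed

text \<open>
  To recognise an algebra in a table it suffices to find a basis with the right products; the
  isomorphism sends it to the standard basis.
\<close>

lemma algebra_iso_frame:
  assumes F: "frame a b c" and m: "bilinear m"
    and mult: "\<And>v w :: real^3. m (v $ 1 *\<^sub>R a + v $ 2 *\<^sub>R b + v $ 3 *\<^sub>R c) (w $ 1 *\<^sub>R a + w $ 2 *\<^sub>R b + w $ 3 *\<^sub>R c)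
      = m' v w $ 1 *\<^sub>R a + m' v w $ 2 *\<^sub>R b + m' v w $ 3 *\<^sub>R c"
  shows "algebra_iso m m'"
proof -
  define g :: "real^3 \<Rightarrow> 'a" where "g = (\<lambda>v. v $ 1 *\<^sub>R a + v $ 2 *\<^sub>R b + v $ 3 *\<^sub>R c)"
  have g: "linear g" "bij g" unfolding g_def by (rule bij_frame_combination[OF F])+
  have "inv g (m x y) = m' (inv g x) (inv g y)" for x y
  proof -
    have "m x y = m (g (inv g x)) (g (inv g y))"
      using g(2) by (simp add: bij_is_surj surj_f_inv_f)
    also have "\<dots> = g (m' (inv g x) (inv g y))"
      by (simp add: g_def mult)
    finally show ?thesis using g(2) by (simp add: bij_is_inj)
  qed
  moreover have "linear (inv g)"
  proof (rule linearI)
    have right: "g (inv g x) = x" for x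
      using g(2) by (simp add: bij_is_surj surj_f_inv_f)
    have left: "inv g (g v) = v" for v
      using g(2) by (simp add: bij_is_inj)
    show "inv g (x + y) = inv g x + inv g y" for x y
      using left[of "inv g x + inv g y"] by (simp add: linear_add[OF g(1)] right)
    show "inv g (k *\<^sub>R x) = k *\<^sub>R inv g x" for k x
      using left[of "k *\<^sub>R inv g x"] by (simp add: linear_scale[OF g(1)] right)
  qed
  ultimately show ?thesis
    using g(2) bij_imp_bij_inv unfolding algebra_iso_def by blast
qed

lemmas table_defs = N30_def N31_def N32_def N33_def B30_def B31_def C31_def C3_def D31_def D32_def E31_def
  G31_def G32_def G33_def G34_def G35_def

lemma bilinear_product_of: "bilinear (product_of ps)"
proof -
  have "product_of ps (x + y) z = product_of ps x z + product_of ps y z"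
    "product_of ps x (y + z) = product_of ps x y + product_of ps x z"
    "product_of ps (k *\<^sub>R x) y = k *\<^sub>R product_of ps x y"
    "product_of ps x (k *\<^sub>R y) = k *\<^sub>R product_of ps x y" for x y z k
    by (induction ps) (auto simp: product_of_def algebra_simps)
  then show ?thesis by (simp add: bilinear_def linear_iff)
qed

lemmas table_simps = table_defs product_of_def bracket_of_def commutator_def axis_def vec_eq_iff forall_3

text \<open>
  In each row the commutator is the listed bracket on the nose, so the identity is the isomorphism
  of Lie algebras.
\<close>

lemma table_entryI:
  assumes "left_symmetric_algebra m" and "\<And>x y. commutator m x y = g x y"
    and "(\<forall>x y z. m (m x y) z = m (m x z) y) \<longleftrightarrow> PropN \<in> P"
    and "(\<forall>x y z. m (m x y) z = m (m z y) x) \<longleftrightarrow> PropD \<in> P"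
    and "(\<forall>x y z. m (commutator m x y) z = 0) \<longleftrightarrow> PropS \<in> P"
  shows "table_entry m g P"
proof -
  have "algebra_iso (commutator m) g"
    unfolding algebra_iso_def using assms(2) by (intro exI[of _ id]) (simp add: linear_id)
  moreover have "has_property m p \<longleftrightarrow> p \<in> P" for p
    using assms by (cases p) (simp_all add: novikov_algebra_def derivation_algebra_def)
  ultimately show ?thesis
    using assms(1) by (auto simp: table_entry_def)
qed

lemma left_symmetric_table:
  "left_symmetric_algebra N30" "left_symmetric_algebra N31" "left_symmetric_algebra N32"
  "left_symmetric_algebra N33" "left_symmetric_algebra B30" "left_symmetric_algebra B31"
  "left_symmetric_algebra C31" "left_symmetric_algebra (C3 t)" "left_symmetric_algebra (D31 \<mu>)"
  "left_symmetric_algebra D32" "left_symmetric_algebra (E31 \<zeta>)"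
  by (simp_all add: left_symmetric_algebra_def bilinear_product_of table_defs)
    (simp_all add: table_simps algebra_simps)

lemma table_N30: "table_entry N30 G31 {PropN, PropD, PropS}"
  by (rule table_entryI) (simp_all add: left_symmetric_table, simp_all add: table_simps)

lemma table_N31: "table_entry N31 G31 {PropN, PropD, PropS}"
  by (rule table_entryI) (simp_all add: left_symmetric_table, simp_all add: table_simps)

lemma table_B30: "table_entry B30 G32 {PropN, PropD, PropS}"
  by (rule table_entryI) (simp_all add: left_symmetric_table, simp_all add: table_simps)

lemma table_C31: "table_entry C31 G33 {PropN, PropD, PropS}"
  by (rule table_entryI) (simp_all add: left_symmetric_table, simp_all add: table_simps algebra_simps)

lemma table_D31: "table_entry (D31 \<mu>) (G34 \<mu>) {PropN, PropD, PropS}"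
  by (rule table_entryI) (simp_all add: left_symmetric_table, simp_all add: table_simps algebra_simps)

lemma table_E31: "table_entry (E31 \<zeta>) (G35 \<zeta>) {PropN, PropD, PropS}"
  by (rule table_entryI) (simp_all add: left_symmetric_table, simp_all add: table_simps algebra_simps)

text \<open>
  In the remaining rows some properties fail, which is seen on products of basis vectors.
\<close>

lemma table_N32: "table_entry N32 G31 {PropS}"
proof (rule table_entryI)
  have "N32 (N32 e3 e3) e2 \<noteq> N32 (N32 e3 e2) e3" "N32 (N32 e3 e3) e2 \<noteq> N32 (N32 e2 e3) e3"
    by (simp_all add: table_simps)
  then show "(\<forall>x y z. N32 (N32 x y) z = N32 (N32 x z) y) \<longleftrightarrow> PropN \<in> {PropS}"
    "(\<forall>x y z. N32 (N32 x y) z = N32 (N32 z y) x) \<longleftrightarrow> PropD \<in> {PropS}" by blast+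
qed (simp_all add: left_symmetric_table, simp_all add: table_simps)

lemma table_N33: "table_entry N33 G31 {PropS}"
proof (rule table_entryI)
  have "N33 (N33 e3 e3) e2 \<noteq> N33 (N33 e3 e2) e3" "N33 (N33 e3 e3) e2 \<noteq> N33 (N33 e2 e3) e3"
    by (simp_all add: table_simps)
  then show "(\<forall>x y z. N33 (N33 x y) z = N33 (N33 x z) y) \<longleftrightarrow> PropN \<in> {PropS}"
    "(\<forall>x y z. N33 (N33 x y) z = N33 (N33 z y) x) \<longleftrightarrow> PropD \<in> {PropS}" by blast+
qed (simp_all add: left_symmetric_table, simp_all add: table_simps)

lemma table_B31: "table_entry B31 G32 {PropD}"
proof (rule table_entryI)
  have "B31 (B31 e1 e2) e1 \<noteq> B31 (B31 e1 e1) e2" "B31 (commutator B31 e1 e2) e1 \<noteq> 0"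
    by (simp_all add: table_simps)
  then show "(\<forall>x y z. B31 (B31 x y) z = B31 (B31 x z) y) \<longleftrightarrow> PropN \<in> {PropD}"
    "(\<forall>x y z. B31 (commutator B31 x y) z = 0) \<longleftrightarrow> PropS \<in> {PropD}" by blast+
qed (simp_all add: left_symmetric_table, simp_all add: table_simps algebra_simps)

lemma table_C3:
  assumes "t \<noteq> 1" shows "table_entry (C3 t) G33 {PropD}"
proof (rule table_entryI)
  have "C3 t (C3 t e1 e2) e1 \<noteq> C3 t (C3 t e1 e1) e2" "C3 t (commutator (C3 t) e1 e2) e1 \<noteq> 0"
    using assms by (simp_all add: table_simps)
  then show "(\<forall>x y z. C3 t (C3 t x y) z = C3 t (C3 t x z) y) \<longleftrightarrow> PropN \<in> {PropD}"
    "(\<forall>x y z. C3 t (commutator (C3 t) x y) z = 0) \<longleftrightarrow> PropS \<in> {PropD}" by blast+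
qed (simp_all add: left_symmetric_table, simp_all add: table_simps algebra_simps)

lemma table_D32: "table_entry D32 (G34 (1/2)) {PropN}"
proof (rule table_entryI)
  have "D32 (D32 e1 e3) e3 \<noteq> D32 (D32 e3 e3) e1" "D32 (commutator D32 e1 e3) e3 \<noteq> 0"
    by (simp_all add: table_simps)
  then show "(\<forall>x y z. D32 (D32 x y) z = D32 (D32 z y) x) \<longleftrightarrow> PropD \<in> {PropN}"
    "(\<forall>x y z. D32 (commutator D32 x y) z = 0) \<longleftrightarrow> PropS \<in> {PropN}" by blast+
qed (simp_all add: left_symmetric_table, simp_all add: table_simps algebra_simps)

section \<open>Complete left-symmetric algebras and their Lie algebras\<close>

locale complete_lsa3 =
  fixes m :: "'a::real_vector \<Rightarrow> 'a \<Rightarrow> 'a" (infixl "\<cdot>" 70)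
  assumes dim3: "dim (UNIV :: 'a set) = 3"
    and lsa: "left_symmetric_algebra m"
    and complete: "complete_algebra m"
begin

abbreviation bracket :: "'a \<Rightarrow> 'a \<Rightarrow> 'a" where "bracket \<equiv> commutator m"

lemma bilinear: "bilinear m"
  using lsa by (simp add: left_symmetric_algebra_def)

lemmas mult_simps = bilinear_ladd[OF bilinear] bilinear_radd[OF bilinear]
  bilinear_lmul[OF bilinear] bilinear_rmul[OF bilinear] bilinear_lneg[OF bilinear]
  bilinear_rneg[OF bilinear] bilinear_lsub[OF bilinear] bilinear_rsub[OF bilinear]
  bilinear_lzero[OF bilinear] bilinear_rzero[OF bilinear]

lemma linear_left: "linear (m x)" and linear_right: "linear (\<lambda>y. y \<cdot> x)"
  using bilinear by (simp_all add: bilinear_def)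

lemma linear_bracket: "linear (bracket x)"
  unfolding commutator_def by (rule linearI) (simp_all add: mult_simps algebra_simps)

text \<open>
  Left-symmetry says that \<open>x \<mapsto> L\<^sub>x\<close> is a representation of the associated Lie algebra.
\<close>

lemma left_mult_bracket: "bracket x y \<cdot> z = x \<cdot> (y \<cdot> z) - y \<cdot> (x \<cdot> z)"
  using lsa by (simp add: left_symmetric_algebra_def commutator_def mult_simps)

text \<open>
  The main use of completeness: with \<open>k = 1\<close> it says that \<open>y \<cdot> x = y\<close> only for \<open>y = 0\<close>.
\<close>

lemma right_eigenvalue_zero:
  assumes "y \<cdot> x = k *\<^sub>R y" "y \<noteq> 0"
  shows "k = 0"
proof -
  obtain n where n: "(\<lambda>y. y \<cdot> x) ^^ n = (\<lambda>y. 0)"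
    using complete by (auto simp: complete_algebra_def nilpotent_operator_def)
  have "((\<lambda>y. y \<cdot> x) ^^ n) y = k ^ n *\<^sub>R y" for n
    by (induction n) (simp_all add: mult_simps assms(1) mult.commute)
  then have "k ^ n *\<^sub>R y = 0" using n by (metis (no_types, lifting))
  then show ?thesis using assms(2) by simp
qed

lemma trace_right: "operator_trace (\<lambda>y. y \<cdot> x) = 0"
  using nilpotent_operator_trace[OF dim3 linear_right] complete by (simp add: complete_algebra_def)

text \<open>
  The traces of \<open>R\<^sub>x\<close> and of its square control its trace and determinant on an invariant plane.
\<close>

lemma trace_right_squared: "operator_trace (\<lambda>y. (y \<cdot> x) \<cdot> x) = 0"
proof (rule nilpotent_operator_trace[OF dim3])
  show "linear (\<lambda>y. (y \<cdot> x) \<cdot> x)"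
    using linear_compose[OF linear_right linear_right] by (simp add: o_def)
  obtain n where n: "(\<lambda>y. y \<cdot> x) ^^ n = (\<lambda>y. 0)"
    using complete by (auto simp: complete_algebra_def nilpotent_operator_def)
  have "(\<lambda>y. (y \<cdot> x) \<cdot> x) = (\<lambda>y. y \<cdot> x) ^^ 2"
    by (simp add: fun_eq_iff numeral_2_eq_2)
  then have "(\<lambda>y. (y \<cdot> x) \<cdot> x) ^^ n = ((\<lambda>y. y \<cdot> x) ^^ n) ^^ 2"
    by (simp only: funpow_mult mult.commute)
  then have "(\<lambda>y. (y \<cdot> x) \<cdot> x) ^^ n = (\<lambda>y. 0)"
    by (simp add: n fun_eq_iff numeral_2_eq_2)
  then show "nilpotent_operator (\<lambda>y. (y \<cdot> x) \<cdot> x)"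
    unfolding nilpotent_operator_def by blast
qed

lemma trace_bracket: "operator_trace (bracket x) = operator_trace (m x)"
proof -
  have "operator_trace (bracket x) = operator_trace (\<lambda>y. x \<cdot> y + (-1) *\<^sub>R (y \<cdot> x))"
    by (simp add: commutator_def[abs_def])
  also have "\<dots> = operator_trace (m x)"
    using operator_trace_algebra(1)[OF dim3 linear_left linear_compose_scale_right[OF linear_right, of "-1"]]
      operator_trace_algebra(2)[OF dim3 linear_right linear_right, of "-1"]
    by (simp add: trace_right)
  finally show ?thesis .
qed

lemma linear_trace_left: "linear (\<lambda>x. operator_trace (m x))"
proof (rule linearI)
  have "m (x + y) = (\<lambda>z. x \<cdot> z + y \<cdot> z)" "m (k *\<^sub>R x) = (\<lambda>z. k *\<^sub>R (x \<cdot> z))" for x y k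
    by (simp_all add: fun_eq_iff mult_simps)
  then show "operator_trace (m (x + y)) = operator_trace (m x) + operator_trace (m y)"
    and "operator_trace (m (k *\<^sub>R x)) = k *\<^sub>R operator_trace (m x)" for x y k
    by (simp_all add: operator_trace_algebra(1,2)[OF dim3 linear_left linear_left])
qed

text \<open>
  \<open>L\<^bsub>[x, y]\<^esub>\<close> is a commutator of operators.
\<close>

lemma trace_left_bracket: "operator_trace (m (bracket x y)) = 0"
proof -
  have lin: "linear (\<lambda>z. x \<cdot> (y \<cdot> z))" "linear (\<lambda>z. y \<cdot> (x \<cdot> z))"
    using linear_compose[OF linear_left linear_left] by (simp_all add: o_def)
  have "m (bracket x y) = (\<lambda>z. x \<cdot> (y \<cdot> z) + (-1) *\<^sub>R (y \<cdot> (x \<cdot> z)))"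
    by (simp add: fun_eq_iff left_mult_bracket)
  then have "operator_trace (m (bracket x y)) =
      operator_trace (\<lambda>z. x \<cdot> (y \<cdot> z)) + (-1) * operator_trace (\<lambda>z. y \<cdot> (x \<cdot> z))"
    using operator_trace_algebra(1)[OF dim3 lin(1) linear_compose_scale_right[OF lin(2), of "-1"]]
      operator_trace_algebra(2)[OF dim3 lin(2) lin(2), of "-1"] by simp
  then show ?thesis
    using operator_trace_algebra(3)[OF dim3 linear_left linear_left, of x y] by simp
qed

text \<open>
  The plane spanned by \<open>u, v\<close> is an abelian ideal on which \<open>ad e\<close> acts, in the basis \<open>u, v\<close>, by
  \<open>a, b, c, d\<close>; the last condition expresses that the Lie algebra is not unimodular.
\<close>

definition adapted :: "'a \<Rightarrow> 'a \<Rightarrow> 'a \<Rightarrow> real \<Rightarrow> real \<Rightarrow> real \<Rightarrow> real \<Rightarrow> bool" where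
  "adapted e u v a b c d \<longleftrightarrow> frame e u v \<and> bracket u v = 0 \<and>
     bracket e u = a *\<^sub>R u + b *\<^sub>R v \<and> bracket e v = c *\<^sub>R u + d *\<^sub>R v \<and> a + d \<noteq> 0"

lemma bracket_simps:
  "bracket x x = 0" "bracket x (y + z) = bracket x y + bracket x z"
  "bracket x (k *\<^sub>R y) = k *\<^sub>R bracket x y" "bracket (x + y) z = bracket x z + bracket y z"
  "bracket (k *\<^sub>R x) y = k *\<^sub>R bracket x y"
  by (simp_all add: commutator_def mult_simps algebra_simps)

lemma bracket_skew: "bracket x y = - bracket y x"
  by (simp add: commutator_def)

text \<open>
  The plane is the kernel of \<open>h x = tr L\<^sub>x = tr (ad x)\<close>, which contains all brackets. If
  \<open>[u, v] = \<alpha> u + \<beta> v\<close> then the traces of \<open>ad u\<close> and \<open>ad v\<close>, which are zero, are \<open>\<beta>\<close> and \<open>- \<alpha>\<close>.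
\<close>

lemma ex_adapted:
  assumes "\<not> unimodular_lie bracket"
  shows "\<exists>e u v a b c d. adapted e u v a b c d"
proof -
  define h where "h x = operator_trace (m x)" for x
  have h: "linear h" unfolding h_def using linear_trace_left .
  have hb: "h (bracket x y) = 0" for x y by (simp add: h_def trace_left_bracket)
  obtain a0 b0 c0 :: 'a where F0: "frame a0 b0 c0" using ex_frame[OF dim3] by blast
  obtain x0 where "h x0 \<noteq> 0"
    using assms by (auto simp: unimodular_lie_def trace_bracket h_def)
  moreover obtain p q r where "x0 = p *\<^sub>R a0 + q *\<^sub>R b0 + r *\<^sub>R c0" using frame_coords[OF F0] .
  ultimately have "h a0 \<noteq> 0 \<or> h b0 \<noteq> 0 \<or> h c0 \<noteq> 0"
    by (auto simp: linear_add[OF h] linear_scale[OF h])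
  moreover have "frame b0 a0 c0"
  proof (rule independent_triple_frame[OF dim3])
    show "p = 0 \<and> q = 0 \<and> r = 0" if "p *\<^sub>R b0 + q *\<^sub>R a0 + r *\<^sub>R c0 = 0" for p q r
      using frame_zero_iff[OF F0, of q p r] that by (simp add: add.commute)
  qed
  moreover have "frame c0 a0 b0"
  proof (rule independent_triple_frame[OF dim3])
    show "p = 0 \<and> q = 0 \<and> r = 0" if "p *\<^sub>R c0 + q *\<^sub>R a0 + r *\<^sub>R b0 = 0" for p q r
      using frame_zero_iff[OF F0, of q r p] that by (simp add: ac_simps)
  qed
  ultimately obtain e b1 c1 where F1: "frame e b1 c1" and he: "h e \<noteq> 0" using F0 by blast
  define u v where "u = b1 - (h b1 / h e) *\<^sub>R e" and "v = c1 - (h c1 / h e) *\<^sub>R e"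
  have F: "frame e u v"
  proof (rule independent_triple_frame[OF dim3])
    fix p q r assume "p *\<^sub>R e + q *\<^sub>R u + r *\<^sub>R v = 0"
    then have "(p - q * (h b1 / h e) - r * (h c1 / h e)) *\<^sub>R e + q *\<^sub>R b1 + r *\<^sub>R c1 = 0"
      by (simp add: u_def v_def algebra_simps)
    then show "p = 0 \<and> q = 0 \<and> r = 0" by (auto simp: frame_zero_iff[OF F1])
  qed
  have hu: "h u = 0" "h v = 0"
    using he by (simp_all add: u_def v_def linear_diff[OF h] linear_scale[OF h])
  have ker: "\<exists>q r. bracket x y = q *\<^sub>R u + r *\<^sub>R v" for x y
  proof -
    obtain p q r where pqr: "bracket x y = p *\<^sub>R e + q *\<^sub>R u + r *\<^sub>R v" using frame_coords[OF F] .
    then have "p = 0" using hb[of x y] he by (simp add: hu linear_add[OF h] linear_scale[OF h])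
    then show ?thesis using pqr by auto
  qed
  obtain a b where eu: "bracket e u = a *\<^sub>R u + b *\<^sub>R v" using ker by blast
  obtain c d where ev: "bracket e v = c *\<^sub>R u + d *\<^sub>R v" using ker by blast
  obtain \<alpha> \<beta> where uv: "bracket u v = \<alpha> *\<^sub>R u + \<beta> *\<^sub>R v" using ker by blast
  have he2: "h e = 0 + a + d" unfolding h_def trace_bracket[symmetric]
    by (rule operator_trace_frame[OF F linear_bracket, where ?q1.0 = 0 and ?r1.0 = 0
        and ?p2.0 = 0 and ?r2.0 = b and ?p3.0 = 0 and ?q3.0 = c]) (simp_all add: eu ev bracket_simps)
  have "h u = 0 + 0 + \<beta>" unfolding h_def trace_bracket[symmetric]
    by (rule operator_trace_frame[OF F linear_bracket, where ?q1.0 = "-a" and ?r1.0 = "-b"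
        and ?p2.0 = 0 and ?r2.0 = 0 and ?p3.0 = 0 and ?q3.0 = \<alpha>])
      (simp_all add: uv bracket_simps bracket_skew[of u e] eu)
  moreover have "h v = 0 + (-\<alpha>) + 0" unfolding h_def trace_bracket[symmetric]
    by (rule operator_trace_frame[OF F linear_bracket, where ?q1.0 = "-c" and ?r1.0 = "-d"
        and ?p2.0 = 0 and ?r2.0 = "-\<beta>" and ?p3.0 = 0 and ?q3.0 = 0])
      (simp_all add: uv bracket_simps bracket_skew[of v e] bracket_skew[of v u] ev)
  ultimately have "bracket u v = 0" using uv hu by simp
  then have "adapted e u v a b c d" using F eu ev he he2 by (simp add: adapted_def)
  then show ?thesis by blast
qed

lemma adapted_trace:
  assumes "adapted e u v a b c d"
  shows "operator_trace (m e) = a + d"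
proof -
  have F: "frame e u v" and eu: "bracket e u = a *\<^sub>R u + b *\<^sub>R v"
    and ev: "bracket e v = c *\<^sub>R u + d *\<^sub>R v" using assms by (auto simp: adapted_def)
  have "operator_trace (bracket e) = 0 + a + d"
    by (rule operator_trace_frame[OF F linear_bracket, where ?q1.0 = 0 and ?r1.0 = 0
        and ?p2.0 = 0 and ?r2.0 = b and ?p3.0 = 0 and ?q3.0 = c]) (simp_all add: eu ev bracket_simps)
  then show ?thesis by (simp add: trace_bracket)
qed

lemma adapted_change:
  assumes A: "adapted e u v a b c d" and det: "\<alpha> * \<delta> - \<beta> * \<gamma> \<noteq> 0"
  shows "\<exists>a' b' c' d'. adapted e (\<alpha> *\<^sub>R u + \<beta> *\<^sub>R v) (\<gamma> *\<^sub>R u + \<delta> *\<^sub>R v) a' b' c' d'"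
proof -
  define f g \<Delta> where "f = \<alpha> *\<^sub>R u + \<beta> *\<^sub>R v" and "g = \<gamma> *\<^sub>R u + \<delta> *\<^sub>R v" and "\<Delta> = \<alpha> * \<delta> - \<beta> * \<gamma>"
  have F: "frame e f g"
    using frame_change[OF dim3, of e u v 1 \<alpha> \<delta> \<beta> \<gamma> 0 0] A det by (simp add: adapted_def f_def g_def)
  have "\<Delta> *\<^sub>R u = \<delta> *\<^sub>R f - \<beta> *\<^sub>R g" "\<Delta> *\<^sub>R v = \<alpha> *\<^sub>R g - \<gamma> *\<^sub>R f"
    by (simp_all add: f_def g_def \<Delta>_def algebra_simps)
  then have uv: "u = (\<delta> / \<Delta>) *\<^sub>R f - (\<beta> / \<Delta>) *\<^sub>R g" "v = (\<alpha> / \<Delta>) *\<^sub>R g - (\<gamma> / \<Delta>) *\<^sub>R f"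
    using det unfolding \<Delta>_def[symmetric]
    by (metis (no_types, lifting) divide_inverse_commute real_vector.scale_left_imp_eq
        real_vector.scale_right_diff_distrib scaleR_scaleR left_inverse scaleR_one)+
  have comb: "\<exists>q' r'. q *\<^sub>R u + r *\<^sub>R v = q' *\<^sub>R f + r' *\<^sub>R g" for q r
    by (rule exI[of _ "q * \<delta> / \<Delta> - r * \<gamma> / \<Delta>"], rule exI[of _ "r * \<alpha> / \<Delta> - q * \<beta> / \<Delta>"])
      (subst uv(1), subst uv(2), simp add: algebra_simps)
  have "bracket f g = 0"
    using A bracket_skew[of v u] by (simp add: adapted_def f_def g_def bracket_simps)
  moreover have "bracket e f = (\<alpha> * a + \<beta> * c) *\<^sub>R u + (\<alpha> * b + \<beta> * d) *\<^sub>R v"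
    "bracket e g = (\<gamma> * a + \<delta> * c) *\<^sub>R u + (\<gamma> * b + \<delta> * d) *\<^sub>R v"
    using A by (simp_all add: adapted_def f_def g_def bracket_simps algebra_simps)
  then obtain a' b' c' d' where D: "bracket e f = a' *\<^sub>R f + b' *\<^sub>R g" "bracket e g = c' *\<^sub>R f + d' *\<^sub>R g"
    using comb by metis
  moreover have "operator_trace (bracket e) = 0 + a' + d'"
    by (rule operator_trace_frame[OF F linear_bracket, where ?q1.0 = 0 and ?r1.0 = 0
        and ?p2.0 = 0 and ?r2.0 = b' and ?p3.0 = 0 and ?q3.0 = c']) (simp_all add: D bracket_simps)
  then have "a' + d' = a + d" using adapted_trace[OF A] by (simp add: trace_bracket)
  ultimately have "adapted e f g a' b' c' d'"
    using F A by (simp add: adapted_def)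
  then show ?thesis unfolding f_def g_def by blast
qed

text \<open>
  Let \<open>P = L\<^sub>e\<close> and let \<open>\<chi>\<close> be the polynomial of the Cayley-Hamilton identity. Division gives
  \<open>- \<chi>(k) = Q (P - k)\<close> with \<open>Q\<close> a polynomial in \<open>P\<close>. Now \<open>(P - k) y = y \<cdot> e\<close> because \<open>y\<close> is an
  eigenvector of \<open>ad e\<close>, and \<open>P\<close> preserves \<open>y \<cdot> A\<close>. So \<open>\<chi>(k) y\<close> lies in \<open>y \<cdot> A\<close>, which is possible only for
  \<open>\<chi>(k) = 0\<close>.
\<close>

lemma bracket_eigenvalue_root:
  assumes CH: "\<And>x. e \<cdot> (e \<cdot> (e \<cdot> x)) = t *\<^sub>R (e \<cdot> (e \<cdot> x)) - p *\<^sub>R (e \<cdot> x) + q *\<^sub>R x"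
    and ey: "bracket e y = k *\<^sub>R y" and y: "y \<noteq> 0"
  shows "k ^ 3 - t * k\<^sup>2 + p * k - q = 0"
proof -
  \<comment> \<open>\<open>P (y \<cdot> x) = y \<cdot> N x\<close>, so \<open>Q (y \<cdot> e) = y \<cdot> z\<close> for the quotient \<open>Q\<close>.\<close>
  define N where "N x = e \<cdot> x + k *\<^sub>R x" for x
  define z where "z = N (N e) + (k - t) *\<^sub>R N e + (k\<^sup>2 - t * k + p) *\<^sub>R e"
  have e1: "e \<cdot> y = k *\<^sub>R y + y \<cdot> e"
    using ey by (simp add: commutator_def algebra_simps)
  have e2: "e \<cdot> (y \<cdot> x) = y \<cdot> (e \<cdot> x) + k *\<^sub>R (y \<cdot> x)" for x
    using left_mult_bracket[of e y x] by (simp add: ey mult_simps algebra_simps)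
  have "y \<cdot> z = (- (k ^ 3 - t * k\<^sup>2 + p * k - q)) *\<^sub>R y"
    using CH[of y]
    by (simp add: z_def N_def e1 e2 mult_simps algebra_simps power2_eq_square power3_eq_cube)
  then show ?thesis using right_eigenvalue_zero y by fastforce
qed

text \<open>
  Being an eigenvector of \<open>ad e\<close> for \<open>0\<close>, the vector \<open>e\<close> makes the constant term vanish.
\<close>

lemma left_characteristic_polynomial:
  assumes A: "adapted e u v a b c d"
  obtains p where
    "\<And>x. e \<cdot> (e \<cdot> (e \<cdot> x)) = (a + d) *\<^sub>R (e \<cdot> (e \<cdot> x)) - p *\<^sub>R (e \<cdot> x)"
    "\<And>k y. bracket e y = k *\<^sub>R y \<Longrightarrow> y \<noteq> 0 \<Longrightarrow> k ^ 3 - (a + d) * k\<^sup>2 + p * k = 0"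
proof -
  obtain p q where CH: "\<And>x. e \<cdot> (e \<cdot> (e \<cdot> x)) = (a + d) *\<^sub>R (e \<cdot> (e \<cdot> x)) - p *\<^sub>R (e \<cdot> x) + q *\<^sub>R x"
    using cayley_hamilton_3[OF dim3 linear_left, of e] adapted_trace[OF A] by metis
  have "e \<noteq> 0" using A frame_zero_iff[of e u v 1 0 0] by (auto simp: adapted_def)
  then have "q = 0" using bracket_eigenvalue_root[OF CH, of e 0] by (simp add: bracket_simps)
  then show thesis using that[of p] CH bracket_eigenvalue_root[OF CH] by simp
qed

text \<open>
  Since \<open>e\<close> is not in the image of \<open>P = L\<^sub>e\<close>, there is a functional \<open>\<phi>\<close> with \<open>\<phi> e = 1\<close> and
  \<open>\<phi> \<circ> P = 0\<close>. It suffices that \<open>\<phi>\<close> vanishes on all products: then it vanishes on the image of \<open>D\<close>,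
  which is the whole plane \<open>U\<close>, so that \<open>U\<close> is its kernel.

  For \<open>y \<in> U\<close> let \<open>\<psi> = \<phi> \<circ> L\<^sub>y\<close>. The representation property gives \<open>\<psi> \<circ> P = - \<phi> \<circ> L\<^bsub>D y\<^esub>\<close>, so the
  Cayley-Hamilton identity of \<open>D\<close> yields \<open>\<psi> \<circ> (P\<^sup>2 + t P + \<delta>) = 0\<close>, where \<open>t\<close> and \<open>\<delta>\<close> are the trace and
  determinant of \<open>D\<close>. That of \<open>P\<close> yields \<open>\<psi> \<circ> P \<circ> (P\<^sup>2 - t P + p) = 0\<close>. These two polynomials have no
  common root, hence \<open>\<psi> = 0\<close>. Indeed \<open>0\<close> is not a root of the first one as \<open>\<delta> \<noteq> 0\<close>, and any other
  common root \<open>w\<close> satisfies \<open>2 t w = p - \<delta>\<close>. If \<open>D\<close> has a real eigenvalue, it is also one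
  of \<open>P\<close>, which means \<open>p = \<delta>\<close> and \<open>w = 0\<close>; otherwise the first polynomial has no real root at all,
  but \<open>w\<close> is real.
\<close>

lemma product_in_plane:
  assumes A: "adapted e u v a b c d" and det: "a * d - b * c \<noteq> 0"
  shows "\<exists>q r. x \<cdot> y = q *\<^sub>R u + r *\<^sub>R v"
proof -
  have F: "frame e u v" and uv: "bracket u v = 0" and eu: "bracket e u = a *\<^sub>R u + b *\<^sub>R v"
    and ev: "bracket e v = c *\<^sub>R u + d *\<^sub>R v" and t: "a + d \<noteq> 0"
    using A by (auto simp: adapted_def)
  have eU: "bracket e (q *\<^sub>R u + r *\<^sub>R v) = (q * a + r * c) *\<^sub>R u + (q * b + r * d) *\<^sub>R v" for q r
    by (simp add: bracket_simps eu ev algebra_simps)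
  have D2: "bracket e (bracket e y) = (a + d) *\<^sub>R bracket e y - (a * d - b * c) *\<^sub>R y"
    if "y = q *\<^sub>R u + r *\<^sub>R v" for y q r
    unfolding that eU by (simp add: algebra_simps)
  have e0: "e \<noteq> 0" using frame_zero_iff[OF F, of 1 0 0] by auto
  obtain p where CH: "\<And>x. e \<cdot> (e \<cdot> (e \<cdot> x)) = (a + d) *\<^sub>R (e \<cdot> (e \<cdot> x)) - p *\<^sub>R (e \<cdot> x)"
    and root: "\<And>k y. bracket e y = k *\<^sub>R y \<Longrightarrow> y \<noteq> 0 \<Longrightarrow> k ^ 3 - (a + d) * k\<^sup>2 + p * k = 0"
    using left_characteristic_polynomial[OF A] by blast
  have "e \<noteq> e \<cdot> y" for y using right_eigenvalue_zero[of e y 1] e0 by auto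
  then have "e \<notin> range (m e)" by blast
  moreover have "subspace (range (m e))"
    using linear_subspace_image[OF linear_left subspace_UNIV] .
  ultimately obtain \<phi> :: "'a \<Rightarrow> real" where \<phi>: "linear \<phi>" "\<phi> e = 1" "\<And>x. \<phi> (e \<cdot> x) = 0"
    using ex_separating_functional by blast
  note \<phi>_lin = linear_add[OF \<phi>(1)] linear_scale[OF \<phi>(1)] linear_diff[OF \<phi>(1)]
  have twist: "\<phi> (y \<cdot> (e \<cdot> x)) = - \<phi> (bracket e y \<cdot> x)" for x y
    by (simp add: left_mult_bracket \<phi>_lin \<phi>(3))
  have killed: "\<phi> (y \<cdot> x) = 0" if y: "y = q *\<^sub>R u + r *\<^sub>R v" for y q r x
  proof -
    \<comment> \<open>The values of \<open>\<psi>\<close> along the orbit of \<open>x\<close> satisfy both linear recurrences.\<close>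
    define s where "s k = \<phi> (y \<cdot> (((m e) ^^ k) x))" for k
    have rec: "\<phi> (y \<cdot> (e \<cdot> (e \<cdot> z))) + (a + d) * \<phi> (y \<cdot> (e \<cdot> z)) + (a * d - b * c) * \<phi> (y \<cdot> z) = 0" for z
      by (simp add: twist D2[OF y] mult_simps \<phi>_lin)
    have s2: "s 2 + (a + d) * s 1 + (a * d - b * c) * s 0 = 0"
      using rec[of x] by (simp add: s_def numeral_2_eq_2)
    have s3: "s 3 + (a + d) * s 2 + (a * d - b * c) * s 1 = 0"
      using rec[of "e \<cdot> x"] by (simp add: s_def numeral_2_eq_2 numeral_3_eq_3)
    have s3': "s 3 = (a + d) * s 2 - p * s 1"
      by (simp add: s_def numeral_2_eq_2 numeral_3_eq_3 CH mult_simps \<phi>_lin)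
    have s4: "s 4 + (a + d) * s 3 + (a * d - b * c) * s 2 = 0"
      using rec[of "e \<cdot> (e \<cdot> x)"] by (simp add: s_def eval_nat_numeral)
    have s4': "s 4 = (a + d) * s 3 - p * s 2"
      by (simp add: s_def eval_nat_numeral CH mult_simps \<phi>_lin)
    have s12: "2 * (a + d) * s 2 = (p - (a * d - b * c)) * s 1"
      and s23: "2 * (a + d) * s 3 = (p - (a * d - b * c)) * s 2"
      using s3 s3' s4 s4' by (auto simp: algebra_simps)
    have "s 1 = 0 \<and> s 2 = 0"
    proof (cases "(a - d)\<^sup>2 + 4 * b * c \<ge> 0")
      case True
      define k where "k = ((a + d) + sqrt ((a - d)\<^sup>2 + 4 * b * c)) / 2"
      have "2 * (x / 2) = x" for x :: real by simp
      then have "2 * k = (a + d) + sqrt ((a - d)\<^sup>2 + 4 * b * c)" unfolding k_def by blast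
      then have "2 * k - (a + d) = sqrt ((a - d)\<^sup>2 + 4 * b * c)" by simp
      then have "(2 * k - (a + d))\<^sup>2 = (a - d)\<^sup>2 + 4 * b * c" using True by simp
      then have k: "k\<^sup>2 - (a + d) * k + (a * d - b * c) = 0"
        by (simp add: power2_eq_square algebra_simps)
      then have k0: "k \<noteq> 0" using det by auto
      obtain q r where qr: "q \<noteq> 0 \<or> r \<noteq> 0" "q * a + r * c = k * q" "q * b + r * d = k * r"
        using ex_eigenvector_2x2[OF k] by blast
      have "bracket e (q *\<^sub>R u + r *\<^sub>R v) = k *\<^sub>R (q *\<^sub>R u + r *\<^sub>R v)"
        unfolding eU qr by (simp add: algebra_simps)
      moreover have "q *\<^sub>R u + r *\<^sub>R v \<noteq> 0" using qr(1) frame_zero_iff[OF F, of 0 q r] by auto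
      ultimately have "k ^ 3 - (a + d) * k\<^sup>2 + p * k = 0" by (rule root)
      then have "k * (k\<^sup>2 - (a + d) * k + p) = 0" 
        by (simp add: power2_eq_square power3_eq_cube algebra_simps)
      then have "p = a * d - b * c" using k k0 by simp
      then show ?thesis using s12 s23 s3 t det by simp
    next
      case False
      define w where "w = (p - (a * d - b * c)) / (2 * (a + d))"
      have w: "s 2 = w * s 1" "s 3 = w * s 2"
        using s12 s23 t by (simp_all add: w_def field_simps)
      have product: "(w\<^sup>2 + (a + d) * w + (a * d - b * c)) * s 1 = 0"
        using s3 w by (simp add: power2_eq_square algebra_simps)
      have "4 * (w\<^sup>2 + (a + d) * w + (a * d - b * c)) = (2 * w + a + d)\<^sup>2 - ((a - d)\<^sup>2 + 4 * b * c)"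
        by (simp add: power2_eq_square algebra_simps)
      moreover have "0 < x" if "4 * x = y - z" "\<not> 0 \<le> z" "0 \<le> y" for x y z :: real
        using that by linarith
      ultimately have "w\<^sup>2 + (a + d) * w + (a * d - b * c) > 0"
        using False zero_le_power2[of "2 * w + a + d"] by blast
      then show ?thesis using w product by simp
    qed
    then have "s 0 = 0" using s2 det by simp
    then show ?thesis by (simp add: s_def)
  qed
  have \<phi>_plane: "\<phi> (q *\<^sub>R u + r *\<^sub>R v) = 0" for q r
  proof -
    let ?y = "q *\<^sub>R u + r *\<^sub>R v"
    have 1: "\<phi> (bracket e (q' *\<^sub>R u + r' *\<^sub>R v)) = 0" for q' r'
      by (simp add: commutator_def[of m e] \<phi>_lin \<phi>(3) killed[OF refl])
    have "\<phi> (bracket e (bracket e ?y)) = 0" unfolding eU[of q r] by (rule 1)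
    then show ?thesis using det 1 by (simp add: D2[OF refl] \<phi>_lin)
  qed
  obtain i j k where x: "x = i *\<^sub>R e + j *\<^sub>R u + k *\<^sub>R v" using frame_coords[OF F] .
  have "\<phi> (x \<cdot> y) = \<phi> (i *\<^sub>R (e \<cdot> y) + (j *\<^sub>R u + k *\<^sub>R v) \<cdot> y)"
    unfolding x by (simp add: mult_simps add.assoc)
  then have 0: "\<phi> (x \<cdot> y) = 0" by (simp add: \<phi>_lin \<phi>(3) killed[OF refl])
  obtain i q r where xy: "x \<cdot> y = i *\<^sub>R e + q *\<^sub>R u + r *\<^sub>R v" using frame_coords[OF F] .
  have "\<phi> (x \<cdot> y) = i * \<phi> e + \<phi> (q *\<^sub>R u + r *\<^sub>R v)" unfolding xy by (simp add: \<phi>_lin)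
  then have "i = 0" using 0 \<phi>(2) \<phi>_plane by simp
  then show ?thesis using xy by auto
qed

lemma right_nilpotent_on_plane:
  assumes F: "frame c a b" and "a \<cdot> x = p *\<^sub>R a + q *\<^sub>R b" "b \<cdot> x = r *\<^sub>R a + s *\<^sub>R b"
    and "c \<cdot> x = k *\<^sub>R a + l *\<^sub>R b"
  shows "p + s = 0" "p * s = q * r"
proof -
  have "operator_trace (\<lambda>y. y \<cdot> x) = 0 + p + s"
    by (rule operator_trace_frame[OF F linear_right, where ?q1.0 = k and ?r1.0 = l
        and ?p2.0 = 0 and ?r2.0 = q and ?p3.0 = 0 and ?q3.0 = r]) (simp_all add: assms)
  then show 1: "p + s = 0" by (simp add: trace_right)
  have "linear (\<lambda>y. (y \<cdot> x) \<cdot> x)"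
    using linear_compose[OF linear_right linear_right] by (simp add: o_def)
  then have "operator_trace (\<lambda>y. (y \<cdot> x) \<cdot> x) = 0 + (p * p + q * r) + (r * q + s * s)"
    by (rule operator_trace_frame[OF F, where ?q1.0 = "k * p + l * r" and ?r1.0 = "k * q + l * s"
        and ?p2.0 = 0 and ?r2.0 = "p * q + q * s" and ?p3.0 = 0 and ?q3.0 = "r * p + s * r"])
      (simp_all add: assms mult_simps algebra_simps)
  then have "p * p + 2 * q * r + s * s = 0" by (simp add: trace_right_squared)
  moreover have "s = - p" using 1 by simp
  ultimately show "p * s = q * r" by (simp add: algebra_simps)
qed

text \<open>
  The multiplications by \<open>a\<close>, \<open>b\<close> and \<open>a + b\<close> are nilpotent on the plane of \<open>a, b\<close>. Their vanishing
  traces and determinants leave only products that are multiples of one vector \<open>g\<close> which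
  annihilates the plane. As \<open>f\<close> one takes \<open>a\<close>, or \<open>b\<close> if \<open>a \<cdot> a = 0\<close>.
\<close>

lemma nilpotent_commutative_plane:
  assumes F: "frame c a b"
    and aa: "a \<cdot> a = p *\<^sub>R a + q *\<^sub>R b" and ab: "a \<cdot> b = r *\<^sub>R a + s *\<^sub>R b"
    and ba: "b \<cdot> a = r *\<^sub>R a + s *\<^sub>R b" and bb: "b \<cdot> b = t *\<^sub>R a + w *\<^sub>R b"
    and ca: "c \<cdot> a = k *\<^sub>R a + l *\<^sub>R b" and cb: "c \<cdot> b = k' *\<^sub>R a + l' *\<^sub>R b"
  shows "(a \<cdot> a = 0 \<and> a \<cdot> b = 0 \<and> b \<cdot> b = 0) \<or>
    (\<exists>\<alpha> \<beta> \<gamma> \<delta> f g. f = \<alpha> *\<^sub>R a + \<beta> *\<^sub>R b \<and> g = \<gamma> *\<^sub>R a + \<delta> *\<^sub>R b \<and> \<alpha> * \<delta> - \<beta> * \<gamma> \<noteq> 0 \<and>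
       f \<cdot> f = g \<and> f \<cdot> g = 0 \<and> g \<cdot> f = 0 \<and> g \<cdot> g = 0)"
proof -
  have 1: "p + s = 0" "p * s = q * r" by (rule right_nilpotent_on_plane[OF F aa ba ca])+
  have 2: "r + w = 0" "r * w = s * t" by (rule right_nilpotent_on_plane[OF F ab bb cb])+
  have "(p + r) * (s + w) = (q + s) * (r + t)"
    by (rule right_nilpotent_on_plane(2)[OF F, of "a + b" _ _ _ _ "k + k'" "l + l'"])
      (simp_all add: mult_simps aa ab ba bb ca cb algebra_simps)
  note 3 = this
  have s: "s = - p" and w: "w = - r" using 1(1) 2(1) by simp_all
  have pq: "p * p + q * r = 0" "r * r = p * t" "p * r + q * t = 0"
    using 1(2) 2(2) 3 unfolding s w by (simp_all add: algebra_simps)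
  consider "q \<noteq> 0" | "q = 0" "t \<noteq> 0" | "q = 0" "t = 0" by blast
  then show ?thesis
  proof cases
    case 1
    define g where "g = p *\<^sub>R a + q *\<^sub>R b"
    have ag: "a \<cdot> g = (p * p + q * r) *\<^sub>R a" "g \<cdot> a = (p * p + q * r) *\<^sub>R a"
      "b \<cdot> g = (p * r + q * t) *\<^sub>R a - (p * p + q * r) *\<^sub>R b"
      by (simp_all add: g_def mult_simps aa ab ba bb s w algebra_simps)
    then have "a \<cdot> g = 0" "g \<cdot> a = 0" "b \<cdot> g = 0" by (simp_all add: pq)
    moreover then have "g \<cdot> g = 0" by (subst (1) g_def) (simp add: mult_simps)
    ultimately show ?thesis using 1 aa g_def
      by (intro disjI2 exI[of _ 1] exI[of _ 0] exI[of _ p] exI[of _ q] exI[of _ a] exI[of _ g]) simp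
  next
    case 2
    then have "p = 0" "r = 0" using pq by auto
    then show ?thesis using 2 s w aa ab ba bb
      by (intro disjI2 exI[of _ 0] exI[of _ 1] exI[of _ t] exI[of _ 0] exI[of _ b] exI[of _ "t *\<^sub>R a"])
        (simp add: mult_simps)
  next
    case 3
    then have "p = 0" "r = 0" using pq by auto
    then show ?thesis using 3 s w aa ab ba bb by simp
  qed
qed

lemma frame_change_plane:
  fixes e u v :: 'a
  assumes "frame e u v" "\<alpha> * \<delta> - \<beta> * \<gamma> \<noteq> 0" "k \<noteq> 0"
  shows "frame (k *\<^sub>R e) (\<alpha> *\<^sub>R u + \<beta> *\<^sub>R v) (\<gamma> *\<^sub>R u + \<delta> *\<^sub>R v)"
  using frame_change[OF dim3 assms(1,3,2), of 0 0] by simp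

text \<open>
  The identities force \<open>ad e\<close> to be triangular on \<open>f, g\<close> with eigenvalues \<open>a\<close> and \<open>2 a\<close>. The
  corrections of \<open>e\<close> by \<open>f\<close> and \<open>g\<close> remove \<open>f \<cdot> e\<close> and \<open>e \<cdot> e\<close>, the one of \<open>f\<close> by \<open>g\<close> turns it into
  an eigenvector.
\<close>

lemma iso_D32:
  assumes A: "adapted e f g a b c d" and plane: "\<And>x y. \<exists>q r. x \<cdot> y = q *\<^sub>R f + r *\<^sub>R g"
    and ff: "f \<cdot> f = g" and fg: "f \<cdot> g = 0" and gf: "g \<cdot> f = 0" and gg: "g \<cdot> g = 0"
  shows "algebra_iso m D32"
proof -
  have F: "frame e f g" and ef': "bracket e f = a *\<^sub>R f + b *\<^sub>R g"
    and eg': "bracket e g = c *\<^sub>R f + d *\<^sub>R g" and t: "a + d \<noteq> 0"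
    using A by (auto simp: adapted_def)
  have g0: "g \<noteq> 0" using frame_zero_iff[OF F, of 0 0 1] by auto
  have fg_eq: "q *\<^sub>R f + r *\<^sub>R g = q' *\<^sub>R f + r' *\<^sub>R g \<longleftrightarrow> q = q' \<and> r = r'" for q r q' r'
    using frame_eq_iff[OF F, of 0 q r 0 q' r'] by simp
  obtain w z where ee: "e \<cdot> e = w *\<^sub>R f + z *\<^sub>R g" using plane by blast
  obtain p q where fe: "f \<cdot> e = p *\<^sub>R f + q *\<^sub>R g" using plane by blast
  obtain r s where ge: "g \<cdot> e = r *\<^sub>R f + s *\<^sub>R g" using plane by blast
  have "f \<cdot> (g \<cdot> e) = g \<cdot> (f \<cdot> e)"
    using left_mult_bracket[of f g e] by (simp add: commutator_def fg gf mult_simps)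
  then have "r = 0" using g0 by (simp add: fe ge mult_simps ff fg gf gg)
  then have "s = 0" using right_eigenvalue_zero[of g e s] ge g0 by simp
  then have "p = 0" using right_nilpotent_on_plane(1)[OF F fe ge ee] by simp
  have fe: "f \<cdot> e = q *\<^sub>R g" and ge: "g \<cdot> e = 0"
    using fe ge \<open>p = 0\<close> \<open>r = 0\<close> \<open>s = 0\<close> by simp_all
  have ef: "e \<cdot> f = a *\<^sub>R f + (b + q) *\<^sub>R g"
    using ef' by (simp add: commutator_def fe algebra_simps)
  have eg: "e \<cdot> g = c *\<^sub>R f + d *\<^sub>R g" using eg' by (simp add: commutator_def ge)
  have "c *\<^sub>R g = 0"
    using left_mult_bracket[of e f g] by (simp add: ef' ef eg mult_simps ff fg gg)
  then have c: "c = 0" using g0 by simp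
  have "a *\<^sub>R g = d *\<^sub>R g - a *\<^sub>R g"
    using left_mult_bracket[of e f f] by (simp add: ef' ef eg c mult_simps ff fg gf)
  then have "a *\<^sub>R g + a *\<^sub>R g = d *\<^sub>R g" by (simp only: eq_diff_eq)
  then have "(a + a - d) *\<^sub>R g = 0" by (simp only: scaleR_add_left scaleR_diff_left diff_self)
  then have d: "d = 2 * a" using g0 by simp
  have a: "a \<noteq> 0" using t d by simp
  have "(a * q) *\<^sub>R g = (2 * a * q) *\<^sub>R g - w *\<^sub>R g"
    using left_mult_bracket[of e f e] 
    by (simp add: ef' ee fe ge eg c d mult_simps ff fg mult.commute mult.left_commute)
  then have "(2 * a * q - w - a * q) *\<^sub>R g = 0" by (simp only: scaleR_diff_left diff_self)
  then have "2 * a * q - w - a * q = 0" using g0 by (simp only: scaleR_eq_0_iff) simp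
  then have w: "w = a * q" by simp
  define y where "y = (q * (b + q) - z) / (2 * a)"
  define e' where "e' = e - q *\<^sub>R f + y *\<^sub>R g"
  define f' where "f' = f - (b / a) *\<^sub>R g"
  have f'e': "f' \<cdot> e' = 0" and ge': "g \<cdot> e' = 0"
    by (simp_all add: e'_def f'_def mult_simps fe ff fg gf gg ge)
  have "(b * 2) *\<^sub>R g = b *\<^sub>R g + b *\<^sub>R g" by (simp only: mult_2_right scaleR_add_left)
  then have e'f': "e' \<cdot> f' = a *\<^sub>R f'" and e'g: "e' \<cdot> g = (2 * a) *\<^sub>R g"
    using a by (simp_all add: e'_def f'_def mult_simps ef eg ff fg gf gg c d algebra_simps scaleR_2)
  have "e' \<cdot> e' = (w - a * q) *\<^sub>R f + (z - q * (b + q) + 2 * a * y) *\<^sub>R g"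
    by (simp add: e'_def mult_simps ef eg ee fe ff fg gf gg ge c d algebra_simps)
  then have e'e': "e' \<cdot> e' = 0" using a w by (simp add: y_def)
  have f'f': "f' \<cdot> f' = g" and f'g: "f' \<cdot> g = 0" and gf': "g \<cdot> f' = 0"
    by (simp_all add: f'_def mult_simps ff fg gf gg)
  have "frame (1 *\<^sub>R e + (- q) *\<^sub>R f + y *\<^sub>R g) (0 *\<^sub>R f + 1 *\<^sub>R g) (1 *\<^sub>R f + (- (b / a)) *\<^sub>R g)"
    by (rule frame_change[OF dim3 F]) simp_all
  then have "frame e' g f'" by (simp add: e'_def f'_def)
  then have "frame ((1 / (2 * a)) *\<^sub>R e') (1 *\<^sub>R g + 0 *\<^sub>R f') (0 *\<^sub>R g + 1 *\<^sub>R f')"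
    by (rule frame_change_plane) (use a in simp_all)
  then have F': "frame ((1 / (2 * a)) *\<^sub>R e') g f'" by simp
  show ?thesis
    by (rule algebra_iso_frame[OF F' bilinear])
      (use a in \<open>simp add: mult_simps e'e' e'f' e'g f'e' ge' f'f' f'g gf' gg table_simps algebra_simps\<close>)
qed

text \<open>
  The operators \<open>ad e\<close> and \<open>R\<^sub>e\<close> satisfy an identity on the plane that forces \<open>ad e\<close> to be the
  scalar \<open>a\<close> plus \<open>b\<close> times the nilpotent \<open>R\<^sub>e\<close>. If \<open>b\<close> is not zero, it can be scaled to \<open>a\<close> by
  changing \<open>g\<close>, and \<open>1 / b\<close> survives as the parameter \<open>t - 1\<close>.
\<close>

lemma iso_B31_C3:
  assumes A: "adapted e f g a b c d" and plane: "\<And>x y. \<exists>q r. x \<cdot> y = q *\<^sub>R f + r *\<^sub>R g"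
    and ff: "f \<cdot> f = 0" and fg: "f \<cdot> g = 0" and gf: "g \<cdot> f = 0" and gg: "g \<cdot> g = 0"
    and fe: "f \<cdot> e = g" and ge: "g \<cdot> e = 0"
  shows "algebra_iso m B31 \<or> (\<exists>t. t \<noteq> 1 \<and> algebra_iso m (C3 t))"
proof -
  have F: "frame e f g" and ef': "bracket e f = a *\<^sub>R f + b *\<^sub>R g"
    and eg': "bracket e g = c *\<^sub>R f + d *\<^sub>R g" and t: "a + d \<noteq> 0"
    using A by (auto simp: adapted_def)
  obtain w z where ee: "e \<cdot> e = w *\<^sub>R f + z *\<^sub>R g" using plane by blast
  have ef: "e \<cdot> f = a *\<^sub>R f + (b + 1) *\<^sub>R g"
    using ef' by (simp add: commutator_def fe algebra_simps)
  have eg: "e \<cdot> g = c *\<^sub>R f + d *\<^sub>R g" using eg' by (simp add: commutator_def ge)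
  have "0 *\<^sub>R e + 0 *\<^sub>R f + a *\<^sub>R g = 0 *\<^sub>R e + c *\<^sub>R f + d *\<^sub>R g"
    using left_mult_bracket[of e f e]
    by (simp add: ef' ee fe ge eg mult_simps ff fg)
  then have c: "c = 0" and d: "d = a" unfolding frame_eq_iff[OF F] by simp_all
  have a: "a \<noteq> 0" using t d by simp
  \<comment> \<open>The coefficients \<open>y\<close> and \<open>x\<close> solve the triangular system \<open>e' \<cdot> e' = 0\<close>.\<close>
  define y where "y = - w / a"
  define x where "x = - (z + y * (b + 2)) / a"
  define e' where "e' = e + y *\<^sub>R f + x *\<^sub>R g"
  have "(y * 2) *\<^sub>R g = y *\<^sub>R g + y *\<^sub>R g" by (simp only: mult_2_right scaleR_add_left)
  then have "e' \<cdot> e' = (w + y * a) *\<^sub>R f + (z + y * (b + 2) + x * a) *\<^sub>R g"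
    by (simp add: e'_def mult_simps ef eg ee fe ff fg gf gg ge c d algebra_simps scaleR_2)
  moreover have "w + y * a = 0" using a by (simp add: y_def)
  moreover have "z + y * (b + 2) + x * a = 0" using a by (simp add: x_def)
  ultimately have e'e': "e' \<cdot> e' = 0" by simp
  have fe': "f \<cdot> e' = g" and ge': "g \<cdot> e' = 0" and e'f: "e' \<cdot> f = a *\<^sub>R f + (b + 1) *\<^sub>R g"
    and e'g: "e' \<cdot> g = a *\<^sub>R g"
    by (simp_all add: e'_def mult_simps ef eg fe ff fg gf gg ge c d)
  have "frame (1 *\<^sub>R e + y *\<^sub>R f + x *\<^sub>R g) (1 *\<^sub>R f + 0 *\<^sub>R g) (0 *\<^sub>R f + 1 *\<^sub>R g)"
    by (rule frame_change[OF dim3 F]) simp_all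
  then have F1: "frame e' f g" by (simp add: e'_def)
  have F2: "frame ((1 / a) *\<^sub>R e') f (l *\<^sub>R g)" if "l \<noteq> 0" for l
    using frame_change_plane[OF F1, of 1 l 0 0 "1 / a"] that a by simp
  note prods = mult_simps e'e' e'f e'g fe' ge' ff fg gf gg
  show ?thesis
  proof (cases "b = 0")
    case True
    have F': "frame ((1 / a) *\<^sub>R e') f ((1 / a) *\<^sub>R g)" using F2 a by simp
    have "algebra_iso m B31"
      by (rule algebra_iso_frame[OF F' bilinear])
        (use a True in \<open>simp add: prods table_simps algebra_simps\<close>)
    then show ?thesis by blast
  next
    case False
    have F': "frame ((1 / a) *\<^sub>R e') f ((b / a) *\<^sub>R g)" using F2 a False by simp
    have "algebra_iso m (C3 ((b + 1) / b))"
      by (rule algebra_iso_frame[OF F' bilinear])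
        (use a False in \<open>simp add: prods table_simps algebra_simps add_divide_distrib\<close>)
    moreover have "(b + 1) / b \<noteq> 1" using False by simp
    ultimately show ?thesis by blast
  qed
qed

text \<open>
  Only the normal form of a \<open>2 \<times> 2\<close> matrix up to conjugation and scaling is at stake. With
  \<open>k\<close> half of its trace and \<open>h\<close> half of \<open>a - d\<close>, its eigenvalues are \<open>k\<close> plus or minus a square root of
  \<open>h\<^sup>2 + b * c\<close>.
\<close>

lemma iso_semidirect:
  assumes F: "frame e u v" and t: "a + d \<noteq> 0" and det: "a * d - b * c \<noteq> 0"
    and u0: "\<And>x. u \<cdot> x = 0" and v0: "\<And>x. v \<cdot> x = 0" and ee: "e \<cdot> e = 0"
    and eu: "e \<cdot> u = a *\<^sub>R u + b *\<^sub>R v" and ev: "e \<cdot> v = c *\<^sub>R u + d *\<^sub>R v"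
  shows "algebra_iso m B30 \<or> algebra_iso m C31
    \<or> (\<exists>\<mu>. 0 < \<bar>\<mu>\<bar> \<and> \<bar>\<mu>\<bar> < 1 \<and> algebra_iso m (D31 \<mu>)) \<or> (\<exists>\<zeta>. \<zeta> > 0 \<and> algebra_iso m (E31 \<zeta>))"
proof -
  have dist: "e \<cdot> (q *\<^sub>R u + r *\<^sub>R v) = (q * a + r * c) *\<^sub>R u + (q * b + r * d) *\<^sub>R v" for q r
    by (simp add: mult_simps eu ev algebra_simps)
  have plane0: "(q *\<^sub>R u + r *\<^sub>R v) \<cdot> x = 0" for q r x by (simp add: mult_simps u0 v0)
  define h where "h = (a - d) / 2"
  define k where "k = (a + d) / 2"
  have k: "k \<noteq> 0" using t by (simp add: k_def)
  have ad: "a = k + h" "d = k - h" by (simp_all add: h_def k_def field_simps)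
  consider "h\<^sup>2 + b * c > 0" | "h\<^sup>2 + b * c = 0" "b = 0" "c = 0" | "h\<^sup>2 + b * c = 0" "b \<noteq> 0 \<or> c \<noteq> 0"
    | "h\<^sup>2 + b * c < 0" by linarith
  then show ?thesis
  proof cases
    case 1
    \<comment> \<open>With this sign \<open>k + s\<close> is the eigenvalue of larger absolute value, which is scaled to \<open>1\<close>.\<close>
    define s where "s = sgn k * sqrt (h\<^sup>2 + b * c)"
    have s2: "s\<^sup>2 = h\<^sup>2 + b * c" using 1 k by (simp add: s_def power_mult_distrib sgn_if)
    have s: "s * k > 0" using 1 k by (simp add: s_def sgn_if mult_less_0_iff)
    have root: "(k + s)\<^sup>2 - (a + d) * (k + s) + (a * d - b * c) = 0"
      "(k - s)\<^sup>2 - (a + d) * (k - s) + (a * d - b * c) = 0"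
      using s2 by (simp_all add: ad power2_eq_square algebra_simps)
    obtain q r where qr: "q \<noteq> 0 \<or> r \<noteq> 0" "q * a + r * c = (k + s) * q" "q * b + r * d = (k + s) * r"
      using ex_eigenvector_2x2[OF root(1)] by blast
    obtain q' r' where qr': "q' \<noteq> 0 \<or> r' \<noteq> 0" "q' * a + r' * c = (k - s) * q'" "q' * b + r' * d = (k - s) * r'"
      using ex_eigenvector_2x2[OF root(2)] by blast
    have ks: "k + s \<noteq> k - s" using s by auto
    have ks0: "k + s \<noteq> 0" "k - s \<noteq> 0" using root det by auto
    define f g where "f = q *\<^sub>R u + r *\<^sub>R v" and "g = q' *\<^sub>R u + r' *\<^sub>R v"
    have ef: "e \<cdot> f = (k + s) *\<^sub>R f" and eg: "e \<cdot> g = (k - s) *\<^sub>R g"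
      unfolding f_def g_def dist qr qr' by (simp_all add: algebra_simps)
    have fx: "f \<cdot> x = 0" and gx: "g \<cdot> x = 0" for x by (simp_all add: f_def g_def plane0)
    have F': "frame ((1 / (k + s)) *\<^sub>R e) f g" unfolding f_def g_def
      using frame_change_plane[OF F eigenvectors_independent_2x2[OF ks qr qr'], of "1 / (k + s)"] ks0 by simp
    have "algebra_iso m (D31 ((k - s) / (k + s)))"
      by (rule algebra_iso_frame[OF F' bilinear])
        (use ks0 in \<open>simp add: mult_simps ef eg fx gx ee table_simps ac_simps\<close>)
    moreover have "\<bar>k - s\<bar> < \<bar>k + s\<bar>"
      using s by (auto simp: abs_if zero_less_mult_iff)
    then have "\<bar>(k - s) / (k + s)\<bar> < 1" using ks0 by (simp add: abs_divide)
    moreover have "0 < \<bar>(k - s) / (k + s)\<bar>" using ks0 by simp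
    ultimately show ?thesis by blast
  next
    case 2
    then have ad': "a = k" "d = k" using ad by simp_all
    have F': "frame ((1 / k) *\<^sub>R e) u v" using frame_change_plane[OF F, of 1 1 0 0 "1 / k"] k by simp
    have "algebra_iso m B30"
      by (rule algebra_iso_frame[OF F' bilinear])
        (use k in \<open>simp add: mult_simps eu ev 2 ad' ee u0 v0 table_simps ac_simps\<close>)
    then show ?thesis by blast
  next
    case 3
    have C31: ?thesis
      if D: "\<alpha> * \<delta> - \<beta> * \<gamma> \<noteq> 0" and f: "f = \<alpha> *\<^sub>R u + \<beta> *\<^sub>R v" and g: "g = \<gamma> *\<^sub>R u + \<delta> *\<^sub>R v"
        and ef: "e \<cdot> f = k *\<^sub>R f + g" and eg: "e \<cdot> g = k *\<^sub>R g" for \<alpha> \<beta> \<gamma> \<delta> f g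
    proof -
      have fx: "f \<cdot> x = 0" and gx: "g \<cdot> x = 0" for x by (simp_all add: f g plane0)
      have "frame ((1 / k) *\<^sub>R e) f g"
        unfolding f g using frame_change_plane[OF F D, of "1 / k"] k by simp
      then have "frame ((1 / k) *\<^sub>R e) (1 *\<^sub>R f + 0 *\<^sub>R g) (0 *\<^sub>R f + (1 / k) *\<^sub>R g)"
        using frame_change_plane[of "(1 / k) *\<^sub>R e" f g 1 "1 / k" 0 0 1] k by simp
      then have F': "frame ((1 / k) *\<^sub>R e) f ((1 / k) *\<^sub>R g)" by simp
      have "algebra_iso m C31"
        by (rule algebra_iso_frame[OF F' bilinear])
          (use k in \<open>simp add: mult_simps ef eg ee fx gx table_simps algebra_simps\<close>)
      then show ?thesis by blast
    qed
    have hh: "h * h = - (b * c)" using 3 by (simp add: power2_eq_square)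
    show ?thesis
    proof (cases "b = 0")
      case True
      then have "h = 0" "c \<noteq> 0" using 3 by auto
      then show ?thesis
        by (intro C31[of 0 0 1 c v "c *\<^sub>R u"]) (use True in \<open>simp_all add: mult_simps eu ev ad\<close>)
    next
      case False
      show ?thesis
        by (rule C31[of 1 b 0 h u "h *\<^sub>R u + b *\<^sub>R v"])
          (use False hh in \<open>simp_all add: mult_simps eu ev ad algebra_simps\<close>)
    qed
  next
    case 4
    \<comment> \<open>The sign makes \<open>\<zeta> = s / k\<close> positive; \<open>g\<close> is the image of \<open>u\<close> under \<open>L\<^sub>e - k\<close>, divided by \<open>s\<close>.\<close>
    define s where "s = sgn k * sqrt (- (h\<^sup>2 + b * c))"
    have s2: "s * s = - (h * h + b * c)" using 4 k by (simp add: s_def sgn_if power2_eq_square)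
    have s: "s / k > 0" using 4 k by (simp add: s_def sgn_if divide_less_0_iff zero_less_divide_iff)
    then have s0: "s \<noteq> 0" by auto
    have b: "b \<noteq> 0" using 4 by auto
    define g where "g = (h / s) *\<^sub>R u + (b / s) *\<^sub>R v"
    have eu': "e \<cdot> u = k *\<^sub>R u + s *\<^sub>R g" using s0 by (simp add: eu g_def ad algebra_simps)
    have coeffs: "h / s * a + b / s * c = k * (h / s) - s" "h / s * b + b / s * d = k * (b / s)"
      using s0 s2 by (simp_all add: ad field_simps)
    have eg: "e \<cdot> g = k *\<^sub>R g - s *\<^sub>R u"
      unfolding g_def dist coeffs by (simp add: algebra_simps)
    have gx: "g \<cdot> x = 0" for x by (simp add: g_def plane0)
    have F': "frame ((1 / k) *\<^sub>R e) u g" unfolding g_def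
      using frame_change_plane[OF F, of 1 "b / s" 0 "h / s" "1 / k"] k b s0 by simp
    have "algebra_iso m (E31 (s / k))"
      by (rule algebra_iso_frame[OF F' bilinear])
        (use k in \<open>simp add: mult_simps eu' eg ee u0 gx table_simps algebra_simps\<close>)
    then show ?thesis using s by blast
  qed
qed

text \<open>
  All products lie in the plane. The cases are: a non-zero product on the plane, a zero product
  there but a non-zero \<open>R\<^sub>e\<close>, and both zero.
\<close>

lemma classification_invertible:
  assumes A: "adapted e u v a b c d" and det: "a * d - b * c \<noteq> 0"
  shows "algebra_iso m B30 \<or> algebra_iso m B31 \<or> algebra_iso m C31
    \<or> (\<exists>t. t \<noteq> 1 \<and> algebra_iso m (C3 t))
    \<or> (\<exists>\<mu>. 0 < \<bar>\<mu>\<bar> \<and> \<bar>\<mu>\<bar> < 1 \<and> algebra_iso m (D31 \<mu>)) \<or> algebra_iso m D32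
    \<or> (\<exists>\<zeta>. \<zeta> > 0 \<and> algebra_iso m (E31 \<zeta>))"
proof -
  have F: "frame e u v" and uv0: "bracket u v = 0" and eu': "bracket e u = a *\<^sub>R u + b *\<^sub>R v"
    and ev': "bracket e v = c *\<^sub>R u + d *\<^sub>R v" and t: "a + d \<noteq> 0"
    using A by (auto simp: adapted_def)
  have plane: "\<exists>q r. x \<cdot> y = q *\<^sub>R u + r *\<^sub>R v" for x y by (rule product_in_plane[OF A det])
  have plane': "\<exists>q r. x \<cdot> y = q *\<^sub>R (\<alpha> *\<^sub>R u + \<beta> *\<^sub>R v) + r *\<^sub>R (\<gamma> *\<^sub>R u + \<delta> *\<^sub>R v)"
    if D: "\<alpha> * \<delta> - \<beta> * \<gamma> \<noteq> 0" for x y \<alpha> \<beta> \<gamma> \<delta>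
  proof -
    define \<Delta> where "\<Delta> = \<alpha> * \<delta> - \<beta> * \<gamma>"
    have "\<Delta> \<noteq> 0" using D by (simp add: \<Delta>_def)
    obtain q r where qr: "x \<cdot> y = q *\<^sub>R u + r *\<^sub>R v" using plane by blast
    have "(q * \<delta> - r * \<gamma>) * \<alpha> + (r * \<alpha> - q * \<beta>) * \<gamma> = \<Delta> * q"
      "(q * \<delta> - r * \<gamma>) * \<beta> + (r * \<alpha> - q * \<beta>) * \<delta> = \<Delta> * r"
      by (simp_all add: \<Delta>_def algebra_simps)
    then have "(q * \<delta> - r * \<gamma>) / \<Delta> * \<alpha> + (r * \<alpha> - q * \<beta>) / \<Delta> * \<gamma> = q"
      "(q * \<delta> - r * \<gamma>) / \<Delta> * \<beta> + (r * \<alpha> - q * \<beta>) / \<Delta> * \<delta> = r"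
      using \<open>\<Delta> \<noteq> 0\<close> by (simp_all add: add_divide_distrib[symmetric])
    then have "x \<cdot> y = ((q * \<delta> - r * \<gamma>) / \<Delta> * \<alpha> + (r * \<alpha> - q * \<beta>) / \<Delta> * \<gamma>) *\<^sub>R u
       + ((q * \<delta> - r * \<gamma>) / \<Delta> * \<beta> + (r * \<alpha> - q * \<beta>) / \<Delta> * \<delta>) *\<^sub>R v" using qr by simp
    also have "\<dots> = ((q * \<delta> - r * \<gamma>) / \<Delta>) *\<^sub>R (\<alpha> *\<^sub>R u + \<beta> *\<^sub>R v) + ((r * \<alpha> - q * \<beta>) / \<Delta>) *\<^sub>R (\<gamma> *\<^sub>R u + \<delta> *\<^sub>R v)"
      by (simp add: scaleR_add_left scaleR_add_right algebra_simps)
    finally show ?thesis by blast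
  qed
  obtain p1 q1 where uu: "u \<cdot> u = p1 *\<^sub>R u + q1 *\<^sub>R v" using plane by blast
  obtain p2 q2 where uv: "u \<cdot> v = p2 *\<^sub>R u + q2 *\<^sub>R v" using plane by blast
  have vu_uv: "v \<cdot> u = u \<cdot> v" using uv0 by (simp add: commutator_def)
  obtain p3 q3 where vv: "v \<cdot> v = p3 *\<^sub>R u + q3 *\<^sub>R v" using plane by blast
  obtain p4 q4 where eu: "e \<cdot> u = p4 *\<^sub>R u + q4 *\<^sub>R v" using plane by blast
  obtain p5 q5 where ev: "e \<cdot> v = p5 *\<^sub>R u + q5 *\<^sub>R v" using plane by blast
  from nilpotent_commutative_plane[OF F uu uv vu_uv[unfolded uv] vv eu ev]
  consider (zero) "u \<cdot> u = 0" "u \<cdot> v = 0" "v \<cdot> v = 0"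
    | (square) \<alpha> \<beta> \<gamma> \<delta> f g where "f = \<alpha> *\<^sub>R u + \<beta> *\<^sub>R v" "g = \<gamma> *\<^sub>R u + \<delta> *\<^sub>R v" 
      "\<alpha> * \<delta> - \<beta> * \<gamma> \<noteq> 0" "f \<cdot> f = g" "f \<cdot> g = 0" "g \<cdot> f = 0" "g \<cdot> g = 0"
    by blast
  then show ?thesis
  proof cases
    case square
    obtain a' b' c' d' where "adapted e f g a' b' c' d'"
      using adapted_change[OF A square(3)] square(1,2) by blast
    then have "algebra_iso m D32"
      using iso_D32 plane'[OF square(3)] square by metis
    then show ?thesis by blast
  next
    case zero
    have vu: "v \<cdot> u = 0" using vu_uv zero by simp
    obtain p q where ue: "u \<cdot> e = p *\<^sub>R u + q *\<^sub>R v" using plane by blast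
    obtain r s where ve: "v \<cdot> e = r *\<^sub>R u + s *\<^sub>R v" using plane by blast
    obtain w z where ee: "e \<cdot> e = w *\<^sub>R u + z *\<^sub>R v" using plane by blast
    note nilpotent = right_nilpotent_on_plane[OF F ue ve ee]
    have s: "s = - p" using nilpotent(1) by simp
    have pq: "p * p + q * r = 0" using nilpotent(2) by (simp add: s)
    have nonzero_right: ?thesis
      if D: "\<alpha> * \<delta> - \<beta> * \<gamma> \<noteq> 0" and f: "f = \<alpha> *\<^sub>R u + \<beta> *\<^sub>R v" and g: "g = \<gamma> *\<^sub>R u + \<delta> *\<^sub>R v"
        and fe: "f \<cdot> e = g" and ge: "g \<cdot> e = 0" for \<alpha> \<beta> \<gamma> \<delta> f g
    proof -
      obtain a' b' c' d' where A': "adapted e f g a' b' c' d'"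
        using adapted_change[OF A D] f g by blast
      have fp: "f \<cdot> f = 0" "f \<cdot> g = 0" "g \<cdot> f = 0" "g \<cdot> g = 0"
        by (simp_all add: f g mult_simps zero vu)
      have "algebra_iso m B31 \<or> (\<exists>t. t \<noteq> 1 \<and> algebra_iso m (C3 t))"
        by (rule iso_B31_C3[OF A' _ fp fe ge]) (use plane'[OF D] f g in blast)
      then show ?thesis by blast
    qed
    consider "q \<noteq> 0" | "q = 0" "r \<noteq> 0" | "q = 0" "r = 0" by blast
    then show ?thesis
    proof cases
      case 1
      show ?thesis
      proof (rule nonzero_right[of 1 q 0 p u "p *\<^sub>R u + q *\<^sub>R v"])
        show "1 * q - 0 * p \<noteq> 0" using 1 by simp
        have "(p *\<^sub>R u + q *\<^sub>R v) \<cdot> e = (p * p + q * r) *\<^sub>R u"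
          by (simp add: mult_simps ue ve s algebra_simps)
        then show "(p *\<^sub>R u + q *\<^sub>R v) \<cdot> e = 0" using pq by simp
      qed (simp_all add: ue)
    next
      case 2
      then have "p = 0" using pq by simp
      show ?thesis
        by (rule nonzero_right[of 0 0 1 r v "r *\<^sub>R u"]) (use 2 \<open>p = 0\<close> in \<open>simp_all add: mult_simps ue ve s\<close>)
    next
      case 3
      then have "p = 0" using pq by simp
      then have ue0: "u \<cdot> e = 0" and ve0: "v \<cdot> e = 0" using ue ve 3 s by simp_all
      have x: "\<exists>i j k. x = i *\<^sub>R e + j *\<^sub>R u + k *\<^sub>R v" for x using F by (simp add: frame_def)
      have u0: "u \<cdot> x = 0" and v0: "v \<cdot> x = 0" for x
        using x[of x] by (auto simp: mult_simps ue0 ve0 zero vu)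
      have eu: "e \<cdot> u = a *\<^sub>R u + b *\<^sub>R v" and ev: "e \<cdot> v = c *\<^sub>R u + d *\<^sub>R v"
        using eu' ev' by (simp_all add: commutator_def u0 v0)
      \<comment> \<open>Cramer's rule for \<open>e' \<cdot> e' = 0\<close>.\<close>
      define y where "y = - (w * d - z * c) / (a * d - b * c)"
      define x where "x = - (z * a - w * b) / (a * d - b * c)"
      define e' where "e' = e + y *\<^sub>R u + x *\<^sub>R v"
      have "w + y * a + x * c = 0" "z + y * b + x * d = 0"
        using det by (simp_all add: x_def y_def divide_simps) (simp_all add: algebra_simps)
      moreover have "e' \<cdot> e' = (w + y * a + x * c) *\<^sub>R u + (z + y * b + x * d) *\<^sub>R v"
        by (simp add: e'_def mult_simps u0 v0 eu ev ee algebra_simps)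
      ultimately have e'e': "e' \<cdot> e' = 0" by simp
      have e'u: "e' \<cdot> u = a *\<^sub>R u + b *\<^sub>R v" and e'v: "e' \<cdot> v = c *\<^sub>R u + d *\<^sub>R v"
        by (simp_all add: e'_def mult_simps u0 v0 eu ev)
      have F': "frame e' u v"
        using frame_change[OF dim3 F, of 1 1 1 0 0 y x] by (simp add: e'_def)
      show ?thesis using iso_semidirect[OF F' t det u0 v0 e'e' e'u e'v] by blast
    qed
  qed
qed


lemma frame_scale:
  fixes a b c :: 'a
  assumes "frame a b c" "i \<noteq> 0" "j \<noteq> 0" "k \<noteq> 0"
  shows "frame (i *\<^sub>R a) (j *\<^sub>R b) (k *\<^sub>R c)"
  using frame_change_plane[OF assms(1), of j k 0 0 i] assms by simp

lemma singular_adapted_eigenbasis: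
  assumes A: "adapted e u v a b c d" and det: "a * d - b * c = 0"
  shows "\<exists>e' f g. adapted e' f g 1 0 0 0"
proof -
  have F: "frame e u v" and uv0: "bracket u v = 0" and eu: "bracket e u = a *\<^sub>R u + b *\<^sub>R v"
    and ev: "bracket e v = c *\<^sub>R u + d *\<^sub>R v" and t: "a + d \<noteq> 0"
    using A by (auto simp: adapted_def)
  have eU: "bracket e (q *\<^sub>R u + r *\<^sub>R v) = (q * a + r * c) *\<^sub>R u + (q * b + r * d) *\<^sub>R v" for q r
    by (simp add: bracket_simps eu ev algebra_simps)
  have roots: "(a + d)\<^sup>2 - (a + d) * (a + d) + (a * d - b * c) = 0"
    "0\<^sup>2 - (a + d) * 0 + (a * d - b * c) = 0"
    using det by (simp_all add: power2_eq_square)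
  obtain q r where qr: "q \<noteq> 0 \<or> r \<noteq> 0" "q * a + r * c = (a + d) * q" "q * b + r * d = (a + d) * r"
    using ex_eigenvector_2x2[OF roots(1)] by blast
  obtain q' r' where qr': "q' \<noteq> 0 \<or> r' \<noteq> 0" "q' * a + r' * c = 0 * q'" "q' * b + r' * d = 0 * r'"
    using ex_eigenvector_2x2[OF roots(2)] by blast
  have D: "q * r' - r * q' \<noteq> 0" by (rule eigenvectors_independent_2x2[OF t qr qr'])
  define f g where "f = q *\<^sub>R u + r *\<^sub>R v" and "g = q' *\<^sub>R u + r' *\<^sub>R v"
  have "bracket e f = (a + d) *\<^sub>R f" "bracket e g = 0"
    unfolding f_def g_def eU qr qr' by (simp_all add: algebra_simps)
  moreover have "bracket f g = 0"
    using uv0 bracket_skew[of v u] by (simp add: f_def g_def bracket_simps)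
  moreover have "frame ((1 / (a + d)) *\<^sub>R e) f g"
    unfolding f_def g_def using frame_change_plane[OF F D, of "1 / (a + d)"] t by simp
  ultimately have "adapted ((1 / (a + d)) *\<^sub>R e) f g 1 0 0 0"
    using t by (simp add: adapted_def bracket_simps)
  then show ?thesis by blast
qed

text \<open>
  Here \<open>P = L\<^sub>e\<close> has the characteristic polynomial \<open>x\<^sup>2 (x - 1)\<close>, its roots \<open>0\<close> and \<open>1\<close> being
  eigenvalues of \<open>ad e\<close> and its trace being \<open>1\<close>. From \<open>P L\<^sub>f = L\<^sub>f P + L\<^sub>f\<close> the image of
  \<open>L\<^sub>f\<close> consists of fixed vectors of \<open>P\<close>. The fixed vectors form the line of \<open>f\<close>, since a second one
  would leave \<open>-1\<close> as the third eigenvalue. So each \<open>f \<cdot> x\<close> is a multiple of \<open>f\<close>, hence zero by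
  completeness.
\<close>

lemma singular_annihilator:
  assumes A: "adapted e f g 1 0 0 0"
  shows "f \<cdot> x = 0" "e \<cdot> f = f" "e \<cdot> (e \<cdot> (e \<cdot> x)) = e \<cdot> (e \<cdot> x)"
    and "e \<cdot> y = y \<Longrightarrow> \<exists>j. y = j *\<^sub>R f"
proof -
  have F: "frame e f g" and ef: "bracket e f = f" and eg: "bracket e g = 0"
    using A by (auto simp: adapted_def)
  have f0: "f \<noteq> 0" using frame_zero_iff[OF F, of 0 1 0] by auto
  obtain p where CH: "\<And>x. e \<cdot> (e \<cdot> (e \<cdot> x)) = (1 + 0) *\<^sub>R (e \<cdot> (e \<cdot> x)) - p *\<^sub>R (e \<cdot> x)"
    and root: "\<And>k y. bracket e y = k *\<^sub>R y \<Longrightarrow> y \<noteq> 0 \<Longrightarrow> k ^ 3 - (1 + 0) * k\<^sup>2 + p * k = 0"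
    using left_characteristic_polynomial[OF A] by blast
  have "p = 0" using root[of f 1] ef f0 by simp
  then have P3: "e \<cdot> (e \<cdot> (e \<cdot> x)) = e \<cdot> (e \<cdot> x)" for x using CH by simp
  then show "e \<cdot> (e \<cdot> (e \<cdot> x)) = e \<cdot> (e \<cdot> x)" .
  have shift: "e \<cdot> (f \<cdot> x) = f \<cdot> (e \<cdot> x) + f \<cdot> x" for x
    using left_mult_bracket[of e f x] by (simp add: ef algebra_simps)
  have rel: "3 *\<^sub>R (f \<cdot> (e \<cdot> (e \<cdot> x))) + f \<cdot> (e \<cdot> x) = 0" for x
  proof -
    have "e \<cdot> (e \<cdot> (e \<cdot> (f \<cdot> x))) - e \<cdot> (e \<cdot> (f \<cdot> x)) = 0" by (simp add: P3)
    moreover have "e \<cdot> (e \<cdot> (e \<cdot> (f \<cdot> x))) - e \<cdot> (e \<cdot> (f \<cdot> x))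
        = (3 *\<^sub>R (f \<cdot> (e \<cdot> (e \<cdot> x))) + f \<cdot> (e \<cdot> x))"
      by (simp add: shift mult_simps P3 scaleR_add_left[of 2 1, simplified] scaleR_2)
    ultimately show ?thesis by simp
  qed
  have "f \<cdot> (e \<cdot> (e \<cdot> x)) = 0" for x
  proof -
    have "4 *\<^sub>R (f \<cdot> (e \<cdot> (e \<cdot> x))) = 0"
      using rel[of "e \<cdot> x"] scaleR_add_left[of 3 1 "f \<cdot> (e \<cdot> (e \<cdot> x))"] by (simp add: P3)
    then show ?thesis by simp
  qed
  then have "f \<cdot> (e \<cdot> x) = 0" for x using rel[of x] by simp
  then have image_fixed: "e \<cdot> (f \<cdot> x) = f \<cdot> x" for x by (simp add: shift)
  have ef_prod: "e \<cdot> f = f + f \<cdot> e" using ef by (simp add: commutator_def algebra_simps)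
  have "f \<cdot> e = 0"
    using P3[of f] by (simp add: ef_prod image_fixed mult_simps algebra_simps)
  then show eff: "e \<cdot> f = f" using ef_prod by simp
  show line: "\<exists>j. y = j *\<^sub>R f" if y: "e \<cdot> y = y" for y
  proof (rule ccontr)
    assume not: "\<nexists>j. y = j *\<^sub>R f"
    obtain i j k where ijk: "y = i *\<^sub>R e + j *\<^sub>R f + k *\<^sub>R g" using frame_coords[OF F] .
    define w where "w = i *\<^sub>R e + k *\<^sub>R g"
    have w: "e \<cdot> w = w"
    proof -
      have "w = y - j *\<^sub>R f" by (simp add: w_def ijk)
      then show ?thesis using y eff by (simp add: mult_simps)
    qed
    have ik: "i \<noteq> 0 \<or> k \<noteq> 0" using not ijk by auto
    have "\<exists>q. frame f w q"
    proof (cases "i = 0")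
      case True
      then have "frame f (0 *\<^sub>R e + k *\<^sub>R g) (1 *\<^sub>R e + 0 *\<^sub>R g)"
        using frame_change_plane[OF frame_swap[OF dim3 F], of 0 0 k 1 1] ik by simp
      then show ?thesis using True by (auto simp: w_def)
    next
      case False
      then have "frame f (i *\<^sub>R e + k *\<^sub>R g) (0 *\<^sub>R e + 1 *\<^sub>R g)"
        using frame_change_plane[OF frame_swap[OF dim3 F], of i 1 k 0 1] by simp
      then show ?thesis by (auto simp: w_def)
    qed
    then obtain q where Fq: "frame f w q" ..
    obtain \<alpha> \<beta> \<rho> where eq: "e \<cdot> q = \<alpha> *\<^sub>R f + \<beta> *\<^sub>R w + \<rho> *\<^sub>R q" using frame_coords[OF Fq] .
    have "operator_trace (m e) = 1 + 1 + \<rho>"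
      by (rule operator_trace_frame[OF Fq linear_left, where ?q1.0 = 0 and ?r1.0 = 0
          and ?p2.0 = 0 and ?r2.0 = 0 and ?p3.0 = \<alpha> and ?q3.0 = \<beta>]) (simp_all add: eff w eq)
    then have \<rho>: "\<rho> = - 1" using adapted_trace[OF A] by simp
    have "0 *\<^sub>R f + 0 *\<^sub>R w + 1 *\<^sub>R q = \<alpha> *\<^sub>R f + \<beta> *\<^sub>R w + (-1) *\<^sub>R q"
      using P3[of q] by (simp add: eq \<rho> mult_simps eff w)
    then show False unfolding frame_eq_iff[OF Fq] by simp
  qed
  obtain j where j: "f \<cdot> x = j *\<^sub>R f" using line[OF image_fixed] by blast
  then show "f \<cdot> x = 0" using right_eigenvalue_zero[OF j f0] by simp
qed

text \<open>
  As \<open>f\<close> annihilates everything from the left, correcting \<open>e\<close> by a multiple of \<open>f\<close> does not change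
  \<open>P = L\<^sub>e\<close>, and it can be used to achieve \<open>P\<^sup>2 e = 0\<close>. Because \<open>L\<^sub>g\<close> commutes with \<open>P\<close>, the
  kernel of \<open>P\<^sup>2\<close> is then a subalgebra with basis \<open>e, g\<close>. A product on it is described by \<open>x \<cdot> x = y\<close>: if
  \<open>y\<close> is a multiple of \<open>g\<close>, it acts trivially on \<open>f\<close>; otherwise a multiple of \<open>y\<close>
  plays the role of \<open>e\<close>, and the sign of its \<open>e\<close>-coordinate \<open>\<gamma>\<close> cannot be scaled away.
\<close>

lemma classification_singular:
  assumes A0: "adapted e0 u v a b c d" and det: "a * d - b * c = 0"
  shows "algebra_iso m N30 \<or> algebra_iso m N31 \<or> algebra_iso m N32 \<or> algebra_iso m N33"
proof -
  obtain e1 f g where A: "adapted e1 f g 1 0 0 0"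
    using singular_adapted_eigenbasis[OF A0 det] by blast
  note ann = singular_annihilator[OF A]
  have F1: "frame e1 f g" and e1g: "bracket e1 g = 0" and fg: "bracket f g = 0"
    using A by (auto simp: adapted_def)
  obtain \<kappa> where \<kappa>: "e1 \<cdot> (e1 \<cdot> e1) = \<kappa> *\<^sub>R f" using ann(3,4) by blast
  \<comment> \<open>\<open>P\<^sup>2\<close> maps \<open>e1\<close> to \<open>\<kappa> f\<close> and fixes \<open>f\<close>.\<close>
  define e where "e = e1 - \<kappa> *\<^sub>R f"
  have F: "frame f e g"
    using frame_swap[OF dim3 frame_change[OF dim3 F1, of 1 1 1 0 0 "- \<kappa>" 0]] by (simp add: e_def)
  have e_mult: "e1 \<cdot> x = e \<cdot> x" for x by (simp add: e_def mult_simps ann(1))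
  note f0 = ann(1) and ef = ann(2)[unfolded e_mult] and P3 = ann(3)[unfolded e_mult]
  have ee: "e \<cdot> (e \<cdot> e) = 0"
  proof -
    have "e \<cdot> (e \<cdot> e) = e \<cdot> (e \<cdot> e1) - \<kappa> *\<^sub>R f" by (subst (3) e_def) (simp add: mult_simps ef)
    then show ?thesis using \<kappa> by (simp add: e_mult)
  qed
  have gf: "g \<cdot> f = 0" using fg f0 by (simp add: commutator_def)
  have eg: "e \<cdot> g = g \<cdot> e"
  proof -
    have "g \<cdot> e = g \<cdot> e1" by (simp add: e_def mult_simps gf)
    then show ?thesis using e1g by (simp add: e_mult commutator_def)
  qed
  have commute: "e \<cdot> (g \<cdot> x) = g \<cdot> (e \<cdot> x)" for x
    using left_mult_bracket[of e g x] eg by (simp add: commutator_def mult_simps)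
  have eeg: "e \<cdot> (e \<cdot> g) = 0"
    using P3[of g] by (simp add: eg commute ee mult_simps)
  have kernel: "\<exists>i k. y = i *\<^sub>R e + k *\<^sub>R g" if y: "e \<cdot> (e \<cdot> y) = 0" for y
  proof -
    obtain j i k where ijk: "y = j *\<^sub>R f + i *\<^sub>R e + k *\<^sub>R g" using frame_coords[OF F] .
    have "e \<cdot> (e \<cdot> y) = j *\<^sub>R f" unfolding ijk by (simp add: mult_simps ef ee eeg)
    moreover have "f \<noteq> 0" using frame_zero_iff[OF F, of 1 0 0] by auto
    ultimately show ?thesis using y ijk by auto
  qed
  obtain p1 q1 where ee_prod: "e \<cdot> e = p1 *\<^sub>R e + q1 *\<^sub>R g" using kernel P3 ee by metis
  have "e \<cdot> (e \<cdot> (e \<cdot> g)) = 0" by (simp add: eeg mult_simps)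
  then obtain p2 q2 where eg_prod: "e \<cdot> g = p2 *\<^sub>R e + q2 *\<^sub>R g" using kernel by metis
  have "e \<cdot> (e \<cdot> (g \<cdot> g)) = 0" by (simp add: commute eeg mult_simps)
  then obtain p3 q3 where gg_prod: "g \<cdot> g = p3 *\<^sub>R e + q3 *\<^sub>R g" using kernel by metis
  have fe: "f \<cdot> e = 0 *\<^sub>R e + 0 *\<^sub>R g" and fg: "f \<cdot> g = 0 *\<^sub>R e + 0 *\<^sub>R g" by (simp_all add: f0)
  from nilpotent_commutative_plane[OF F ee_prod eg_prod eg_prod[unfolded eg] gg_prod fe fg]
  consider (zero) "e \<cdot> e = 0" "e \<cdot> g = 0" "g \<cdot> g = 0"
    | (square) \<alpha> \<beta> \<gamma> \<delta> x y where "x = \<alpha> *\<^sub>R e + \<beta> *\<^sub>R g" "y = \<gamma> *\<^sub>R e + \<delta> *\<^sub>R g" 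
      "\<alpha> * \<delta> - \<beta> * \<gamma> \<noteq> 0" "x \<cdot> x = y" "x \<cdot> y = 0" "y \<cdot> x = 0" "y \<cdot> y = 0"
    by blast
  then show ?thesis
  proof cases
    case zero
    have "algebra_iso m N30"
      by (rule algebra_iso_frame[OF frame_swap[OF dim3 F] bilinear])
        (simp add: mult_simps zero eg[symmetric] ef gf f0 table_simps)
    then show ?thesis by blast
  next
    case square
    have xf: "x \<cdot> f = \<alpha> *\<^sub>R f" and yf: "y \<cdot> f = \<gamma> *\<^sub>R f"
      by (simp_all add: square(1,2) mult_simps ef gf)
    have Fxy: "frame f x y"
      using frame_change_plane[OF F square(3), of 1] square(1,2) by simp
    show ?thesis
    proof (cases "\<gamma> = 0")
      case True
      then have \<alpha>: "\<alpha> \<noteq> 0" using square(3) by auto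
      have F': "frame ((1 / \<alpha>) *\<^sub>R x) f ((1 / \<alpha>\<^sup>2) *\<^sub>R y)"
        using frame_swap[OF dim3 frame_scale[OF Fxy, of 1 "1 / \<alpha>" "1 / \<alpha>\<^sup>2"]] \<alpha> by simp
      have "algebra_iso m N31"
        by (rule algebra_iso_frame[OF F' bilinear])
          (use \<alpha> True in \<open>simp add: mult_simps square(4-7) xf yf f0 table_simps power2_eq_square ac_simps\<close>)
      then show ?thesis by blast
    next
      case False
      define s where "s = sqrt \<bar>\<gamma>\<bar>"
      have s: "s \<noteq> 0" "s * s = \<bar>\<gamma>\<bar>" using False by (simp_all add: s_def)
      \<comment> \<open>The multiple of \<open>y\<close> makes \<open>z\<close> act trivially on \<open>f\<close>; scaling by \<open>s\<close> leaves only the sign of \<open>\<gamma>\<close>.\<close>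
      define z where "z = (1 / s) *\<^sub>R x - (\<alpha> / (\<gamma> * s)) *\<^sub>R y"
      have zf: "z \<cdot> f = 0" using False by (simp add: z_def mult_simps xf yf)
      have zz: "z \<cdot> z = (1 / \<bar>\<gamma>\<bar>) *\<^sub>R y"
        using s by (simp add: z_def mult_simps square(4-7))
      have zy: "z \<cdot> y = 0" "y \<cdot> z = 0" by (simp_all add: z_def mult_simps square(4-7))
      have "frame (1 *\<^sub>R f) (0 *\<^sub>R x + (1 / \<gamma>) *\<^sub>R y) ((1 / s) *\<^sub>R x + (- (\<alpha> / (\<gamma> * s))) *\<^sub>R y)"
        by (rule frame_change_plane[OF Fxy]) (use s False in simp_all)
      then have F': "frame ((1 / \<gamma>) *\<^sub>R y) f z"
        using frame_swap[OF dim3] by (simp add: z_def)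
      show ?thesis
      proof (cases "\<gamma> > 0")
        case True
        have "algebra_iso m N32"
          by (rule algebra_iso_frame[OF F' bilinear])
            (use True in \<open>simp add: mult_simps square(7) zz zy zf yf f0 table_simps ac_simps\<close>)
        then show ?thesis by blast
      next
        case neg: False
        then have "\<bar>\<gamma>\<bar> = - \<gamma>" by simp
        have "algebra_iso m N33"
          by (rule algebra_iso_frame[OF F' bilinear])
            (use False \<open>\<bar>\<gamma>\<bar> = - \<gamma>\<close> in \<open>simp add: mult_simps square(7) zz zy zf yf f0 table_simps ac_simps\<close>)
        then show ?thesis by blast
      qed
    qed
  qed
qed

end

section \<open>The classification\<close>

theorem theorem12:
  fixes m :: "'a::real_vector \<Rightarrow> 'a \<Rightarrow> 'a"
  assumes "dim (UNIV :: 'a set) = 3"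
    and "left_symmetric_algebra m"
    and "complete_algebra m"
    and "solvable_lie (commutator m)"
    and "\<not> unimodular_lie (commutator m)"
  shows
    "(algebra_iso m N30
      \<or> algebra_iso m N31
      \<or> algebra_iso m N32
      \<or> algebra_iso m N33
      \<or> algebra_iso m B30
      \<or> algebra_iso m B31
      \<or> algebra_iso m C31
      \<or> (\<exists>t. t \<noteq> 1 \<and> algebra_iso m (C3 t))
      \<or> (\<exists>\<mu>. 0 < \<bar>\<mu>\<bar> \<and> \<bar>\<mu>\<bar> < 1 \<and> algebra_iso m (D31 \<mu>))
      \<or> algebra_iso m D32
      \<or> (\<exists>\<zeta>. \<zeta> > 0 \<and> algebra_iso m (E31 \<zeta>)))
   \<and> table_entry N30 G31 {PropN, PropD, PropS}
   \<and> table_entry N31 G31 {PropN, PropD, PropS}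
   \<and> table_entry N32 G31 {PropS}
   \<and> table_entry N33 G31 {PropS}
   \<and> table_entry B30 G32 {PropN, PropD, PropS}
   \<and> table_entry B31 G32 {PropD}
   \<and> table_entry C31 G33 {PropN, PropD, PropS}
   \<and> (\<forall>t. t \<noteq> 1 \<longrightarrow> table_entry (C3 t) G33 {PropD})
   \<and> (\<forall>\<mu>. 0 < \<bar>\<mu>\<bar> \<and> \<bar>\<mu>\<bar> < 1 \<longrightarrow> table_entry (D31 \<mu>) (G34 \<mu>) {PropN, PropD, PropS})
   \<and> table_entry D32 (G34 (1/2)) {PropN}
   \<and> (\<forall>\<zeta>. \<zeta> > 0 \<longrightarrow> table_entry (E31 \<zeta>) (G35 \<zeta>) {PropN, PropD, PropS})"
proof -
  interpret complete_lsa3 m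
    using assms(1-3) by unfold_locales
  obtain e u v a b c d where A: "adapted e u v a b c d"
    using ex_adapted[OF assms(5)] by blast
  note tables = table_N30 table_N31 table_N32 table_N33 table_B30 table_B31 table_C31
    table_C3 table_D31 table_D32 table_E31
  show ?thesis
  proof (cases "a * d - b * c = 0")
    case True
    show ?thesis using classification_singular[OF A True] tables by blast
  next
    case False
    show ?thesis using classification_invertible[OF A False] tables by blast
  qed
qed

end
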